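(* Let $d\ge1$, $N_o\ge0$ and $\tau,\lambda>0$, and assume that the Cox point process $X^{\lambda'}$ is nonequidistant for all $\lambda'>0$. Then $\gamma(\lambda)\le \dfrac{1}{2\tau}$.
   Context: Marked Cox point process. $\Lambda$ is a stationary random measure on $\mathbb R^d$ with $\mathbb E[\Lambda([-1/2,1/2]^d)]=1$, and $\mu$ is a Borel probability measure on $[0,\infty)$. For $\lambda>0$, $\mathbf X^\lambda=\{(X_i,P_i)\}_{i\in I}$ is the i.i.d. marked Cox point process on $\mathbb R^d\times[0,\infty)$ with directing measure $\lambda\Lambda\otimes\mu$ (conditionally on $\Lambda$ it is a Poisson point process with intensity measure $\lambda\Lambda\otimes\mu$), and $X^\lambda=\{X_i\}_{i\in I}$. No further restriction is imposed on $\Lambda$, on $\mu$, or on the path-loss function $\ell:[0,\infty)\to[0,\infty)$. SINR graph. Given $\tau>0$, $N_o\ge0$, $\ell$ and $\gamma\ge0$, the SINR graph $G_\gamma(\mathbf X^\lambda)$ has vertex set $X^\lambda$, and $X_i\ne X_j$ are joined by an edge iff $$P_i\ell(|X_i-X_j|)>\tau\Big(N_o+\gamma\sum_{k\in I\setminus\{i,j\}}P_k\ell(|X_k-X_j|)\Big)\ \text{ and }\ P_j\ell(|X_i-X_j|)>\tau\Big(N_o+\gamma\sum_{k\in I\setminus\{i,j\}}P_k\ell(|X_k-X_i|)\Big).$$ A graph with locally finite vertex set in $\mathbb R^d$ percolates if it has an unbounded connected component. Define $\gamma(\lambda)=\sup\{\gamma>0:\mathbb P(G_\gamma(\mathbf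 X^\lambda)\text{ percolates})>0\}$, with $\sup\emptyset=0$. $X^\lambda$ is nonequidistant if almost surely, for all $i,j,k,l\in I$: $|X_i-X_j|=|X_k-X_l|>0$ implies $\{i,j\}=\{k,l\}$, and $|X_i|=|X_j|$ implies $i=j$. *)

theory Defs
  imports "HOL-Probability.Probability"
begin

section \<open>Stationary random measures\<close>

definition locally_finite_measures :: "'a::euclidean_space measure set" where
  "locally_finite_measures =
    {L. sets L = sets borel \<and> (\<forall>B\<in>sets borel. bounded B \<longrightarrow> emeasure L B < \<infinity>)}"

text \<open>The usual \<open>\<sigma>\<close>-algebra on the space of locally finite measures, generated by the
  evaluations \<open>L \<mapsto> L(B)\<close>; compare \<^const>\<open>subprob_algebra\<close>.\<close>

definition random_measure_algebra :: "'a::euclidean_space measure measure" where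
  "random_measure_algebra =
    (SUP B\<in>sets borel. vimage_algebra locally_finite_measures (\<lambda>L. emeasure L B) borel)"

definition stationary_random_measure ::
    "'w measure \<Rightarrow> ('w \<Rightarrow> 'a::euclidean_space measure) \<Rightarrow> bool" where
  "stationary_random_measure M \<Lambda> \<longleftrightarrow>
    \<Lambda> \<in> measurable M random_measure_algebra \<and>
    (\<forall>x. distr M random_measure_algebra (\<lambda>\<omega>. distr (\<Lambda> \<omega>) borel (\<lambda>y. x + y))
         = distr M random_measure_algebra \<Lambda>)"

definition unit_cube :: "'a::euclidean_space set" where
  "unit_cube = cbox ((- 1 / 2) *\<^sub>R One) ((1 / 2) *\<^sub>R One)"

section \<open>Marked Cox point processes\<close>

text \<open>A marked point process is given as a family of points and marks with a random index set
  \<open>I \<omega> \<subseteq> \<nat>\<close>; multiple points are allowed. The values of \<open>X i\<close> and \<open>P i\<close> at \<open>\<omega>\<close> are irrelevant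
  when \<open>i \<notin> I \<omega>\<close>.\<close>

abbreviation mark_space :: "real measure" where
  "mark_space \<equiv> restrict_space borel {0..}"

definition marked_point_process ::
    "'w measure \<Rightarrow> ('w \<Rightarrow> nat set) \<Rightarrow> (nat \<Rightarrow> 'w \<Rightarrow> 'a::euclidean_space) \<Rightarrow> (nat \<Rightarrow> 'w \<Rightarrow> real) \<Rightarrow> bool"
  where
  "marked_point_process M I X P \<longleftrightarrow>
    (\<forall>i. {\<omega>\<in>space M. i \<in> I \<omega>} \<in> sets M) \<and>
    (\<forall>i. X i \<in> borel_measurable M) \<and>
    (\<forall>i. P i \<in> measurable M mark_space) \<and>
    (\<forall>\<omega>\<in>space M. \<forall>B. bounded B \<longrightarrow> finite {i\<in>I \<omega>. X i \<omega> \<in> B})"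

definition point_count ::
    "('w \<Rightarrow> nat set) \<Rightarrow> (nat \<Rightarrow> 'w \<Rightarrow> 'a) \<Rightarrow> (nat \<Rightarrow> 'w \<Rightarrow> real) \<Rightarrow> ('a \<times> real) set \<Rightarrow> 'w \<Rightarrow> nat" where
  "point_count I X P B \<omega> = card {i\<in>I \<omega>. (X i \<omega>, P i \<omega>) \<in> B}"

text \<open>Written out because \<^const>\<open>poisson_pmf\<close> is only specified for a positive rate; rate \<open>0\<close> gives
  the point mass at \<open>0\<close>.\<close>

definition poisson_weight :: "real \<Rightarrow> nat \<Rightarrow> real" where
  "poisson_weight r k = r ^ k / fact k * exp (- r)"

text \<open>Conditionally on \<open>\<Lambda>\<close>, the counts of pairwise disjoint sets are independent Poisson variables
  with means given by \<open>a\<Lambda> \<otimes> \<mu>\<close>. The sets are bounded in the location coordinate, so that these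
  means are finite.\<close>

definition marked_cox_process ::
    "'w measure \<Rightarrow> ('w \<Rightarrow> 'a::euclidean_space measure) \<Rightarrow> real measure \<Rightarrow> real \<Rightarrow>
     ('w \<Rightarrow> nat set) \<Rightarrow> (nat \<Rightarrow> 'w \<Rightarrow> 'a) \<Rightarrow> (nat \<Rightarrow> 'w \<Rightarrow> real) \<Rightarrow> bool" where
  "marked_cox_process M \<Lambda> \<mu> a I X P \<longleftrightarrow>
    marked_point_process M I X P \<and>
    (\<forall>(n::nat) B (k :: nat \<Rightarrow> nat).
      (\<forall>m<n. B m \<in> sets (borel \<Otimes>\<^sub>M mark_space) \<and> bounded (fst ` B m)) \<longrightarrow>
      disjoint_family_on B {..<n} \<longrightarrow>
      (AE \<omega> in M.
        real_cond_exp M (vimage_algebra (space M) \<Lambda> random_measure_algebra)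
          (indicator {\<omega>\<in>space M. \<forall>m<n. point_count I X P (B m) \<omega> = k m}) \<omega>
        = (\<Prod>m<n. poisson_weight
                     (measure (scale_measure (ennreal a) (\<Lambda> \<omega>) \<Otimes>\<^sub>M \<mu>) (B m)) (k m))))"

definition nonequidistant ::
    "'w measure \<Rightarrow> ('w \<Rightarrow> nat set) \<Rightarrow> (nat \<Rightarrow> 'w \<Rightarrow> 'a::euclidean_space) \<Rightarrow> bool" where
  "nonequidistant M I X \<longleftrightarrow>
    (AE \<omega> in M.
      (\<forall>i\<in>I \<omega>. \<forall>j\<in>I \<omega>. \<forall>k\<in>I \<omega>. \<forall>l\<in>I \<omega>.
         dist (X i \<omega>) (X j \<omega>) = dist (X k \<omega>) (X l \<omega>) \<and> dist (X k \<omega>) (X l \<omega>) > 0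
           \<longrightarrow> {i, j} = {k, l}) \<and>
      (\<forall>i\<in>I \<omega>. \<forall>j\<in>I \<omega>. norm (X i \<omega>) = norm (X j \<omega>) \<longrightarrow> i = j))"

section \<open>The SINR graph and percolation\<close>

text \<open>Interference at \<open>X j\<close> with respect to the transmitter \<open>X i\<close>; the series may diverge.\<close>

definition interference ::
    "(real \<Rightarrow> real) \<Rightarrow> nat set \<Rightarrow> (nat \<Rightarrow> 'a::euclidean_space) \<Rightarrow> (nat \<Rightarrow> real) \<Rightarrow> nat \<Rightarrow> nat \<Rightarrow> ennreal"
  where
  "interference ell I X P i j = (\<Sum>\<^sub>\<infinity>k\<in>I - {i, j}. ennreal (P k * ell (dist (X k) (X j))))"

definition sinr_condition ::
    "real \<Rightarrow> real \<Rightarrow> (real \<Rightarrow> real) \<Rightarrow> real \<Rightarrow>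
     nat set \<Rightarrow> (nat \<Rightarrow> 'a::euclidean_space) \<Rightarrow> (nat \<Rightarrow> real) \<Rightarrow> nat \<Rightarrow> nat \<Rightarrow> bool" where
  "sinr_condition \<tau> N\<^sub>o ell \<gamma> I X P i j \<longleftrightarrow>
    ennreal (P i * ell (dist (X i) (X j)))
      > ennreal \<tau> * (ennreal N\<^sub>o + ennreal \<gamma> * interference ell I X P i j)"

text \<open>The edge set as a symmetric relation on the vertex set \<open>X ` I\<close>.\<close>

definition sinr_edges ::
    "real \<Rightarrow> real \<Rightarrow> (real \<Rightarrow> real) \<Rightarrow> real \<Rightarrow>
     nat set \<Rightarrow> (nat \<Rightarrow> 'a::euclidean_space) \<Rightarrow> (nat \<Rightarrow> real) \<Rightarrow> ('a \<times> 'a) set" where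
  "sinr_edges \<tau> N\<^sub>o ell \<gamma> I X P =
    {(X i, X j) | i j. i \<in> I \<and> j \<in> I \<and> X i \<noteq> X j \<and>
       sinr_condition \<tau> N\<^sub>o ell \<gamma> I X P i j \<and> sinr_condition \<tau> N\<^sub>o ell \<gamma> I X P j i}"

definition percolates :: "'a::euclidean_space set \<Rightarrow> ('a \<times> 'a) set \<Rightarrow> bool" where
  "percolates V E \<longleftrightarrow> (\<exists>x\<in>V. \<not> bounded (E\<^sup>* `` {x}))"

text \<open>The supremum is taken in \<^typ>\<open>ennreal\<close>: it may a priori be infinite, and the supremum of the
  empty set is \<open>0\<close>.\<close>

definition critical_gamma ::
    "'w measure \<Rightarrow> real \<Rightarrow> real \<Rightarrow> (real \<Rightarrow> real) \<Rightarrow>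
     ('w \<Rightarrow> nat set) \<Rightarrow> (nat \<Rightarrow> 'w \<Rightarrow> 'a::euclidean_space) \<Rightarrow> (nat \<Rightarrow> 'w \<Rightarrow> real) \<Rightarrow> ennreal" where
  "critical_gamma M \<tau> N\<^sub>o ell I X P =
    Sup {ennreal \<gamma> | \<gamma>. \<gamma> > 0 \<and>
      measure M {\<omega>\<in>space M. percolates ((\<lambda>i. X i \<omega>) ` I \<omega>)
         (sinr_edges \<tau> N\<^sub>o ell \<gamma> (I \<omega>) (\<lambda>i. X i \<omega>) (\<lambda>i. P i \<omega>))} > 0}"

end

theory Submission
  imports Defs
begin

text \<open>Let \<open>\<gamma> > 1 / (2 \<tau>)\<close>. If a point had three neighbours in the SINR graph, each of the three received
  powers would exceed \<open>\<tau> \<gamma> > 1/2\<close> times the sum of the other two, which is impossible. So all degrees are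
  at most two, and every infinite component is a one-sided or two-sided infinite path. It
  suffices to rule out both almost surely, since then the graph does not percolate for any such \<open>\<gamma>\<close>.

  One-sided infinite paths cannot occur in a stationary process of finite intensity: let every point of
  such a path send unit mass to the end of the path. Then the mean mass sent per unit volume is
  finite, whereas an end would receive infinite mass (\<open>no_ray_end_if_stationary\<close>).

  Two-sided infinite paths are reduced to this case. Let \<open>s\<close> lie on such a path and let \<open>a\<close> be one of its
  two neighbours. Because the interference at \<open>s\<close> is finite, only finitely many points other than \<open>a\<close> have
  a signal that can be heard at \<open>s\<close> in the presence of \<open>a\<close>. Delete these points, except those on the
  half of the path that starts at \<open>s\<close> through \<open>a\<close>. Deleting points lowers the interference and so preserves all
  other edges. Every point beyond \<open>a\<close> on the remaining half path still has its two old neighbours and is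
  thus not available as a new neighbour of \<open>s\<close>. Hence \<open>s\<close> has become the end of an infinite component
  (\<open>exists_pruning\<close>). On the other hand, a Cox process is deletion tolerant: conditionally on the
  directing measure, it has no point in a given bounded region with positive probability, independently
  of the points outside. A property that holds almost surely
  therefore holds almost surely also after deletion of all points in a fixed bounded region
  (\<open>deletion_tolerance\<close>). Since countably many regions suffice to cut out all finite
  sets of points, infinite paths of either type would contradict the first part
  (\<open>AE_no_infinite_component\<close>).

  The stationarity of the marked process is derived from that of the directing measure. To this end
  the process is regarded as a random set of marked points, with the \<open>\<sigma>\<close>-algebra that is generated by
  the counts in bounded windows, and all functionals of the graph have to be shown to be measurable
  with respect to it.\<close>

section \<open>Graphs with degrees at most two\<close>

text \<open>Graphs are given by their edge relations; for the symmetric relations below this says that every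
  vertex has at most two neighbours.\<close>

definition max_degree_2 :: "('v \<times> 'v) set \<Rightarrow> bool" where
  "max_degree_2 R \<longleftrightarrow>
    (\<forall>s a b c. (s, a) \<in> R \<and> (s, b) \<in> R \<and> (s, c) \<in> R \<longrightarrow> a = b \<or> a = c \<or> b = c)"

text \<open>A vertex with at most one neighbour whose connected component is infinite. In a graph with degrees
  at most two it is the starting point of a one-sided infinite path.\<close>

definition ray_end :: "('v \<times> 'v) set \<Rightarrow> 'v \<Rightarrow> bool" where
  "ray_end R e \<longleftrightarrow>
    (\<forall>a b. (e, a) \<in> R \<and> (e, b) \<in> R \<longrightarrow> a = b) \<and> infinite (R\<^sup>* `` {e})"

lemma max_degree_2D:
  "max_degree_2 R \<Longrightarrow> (s, a) \<in> R \<Longrightarrow> (s, b) \<in> R \<Longrightarrow> a \<noteq> b \<Longrightarrow> (s, c) \<in> R \<Longrightarrow> c = a \<or> c = b"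
  unfolding max_degree_2_def by metis

lemma rtrancl_image_subset:
  assumes "x \<in> V" and "\<And>u v. u \<in> V \<Longrightarrow> (u, v) \<in> R \<Longrightarrow> v \<in> V"
  shows "R\<^sup>* `` {x} \<subseteq> V"
proof -
  have "y \<in> V" if "(x, y) \<in> R\<^sup>*" for y
    using that by (induction rule: rtrancl_induct) (use assms in auto)
  then show ?thesis by auto
qed

text \<open>The second end \<open>e'\<close> need not be assumed to have an infinite component. A shortest walk from
  \<open>e\<close> to a different \<open>e'\<close> never turns back, so each inner vertex already has its two neighbours on
  the walk, and each of the two ends its only one. The walk is then closed under adjacency and
  exhausts the component of \<open>e\<close>, which would be finite.\<close>

lemma ray_end_unique:
  assumes deg: "max_degree_2 R" and "sym R"
    and e: "ray_end R e" and e': "\<And>a b. (e', a) \<in> R \<Longrightarrow> (e', b) \<in> R \<Longrightarrow> a = b"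
    and reach: "(e, e') \<in> R\<^sup>*"
  shows "e = e'"
proof (rule ccontr)
  assume ne: "e \<noteq> e'"
  \<comment> \<open>The length of a shortest walk from \<open>e\<close> to \<open>e'\<close>.\<close>
  define n where "n = (LEAST n. (e, e') \<in> R ^^ n)"
  have ex: "\<exists>n. (e, e') \<in> R ^^ n"
    using reach by (simp add: rtrancl_is_UN_relpow)
  have n: "(e, e') \<in> R ^^ n"
    unfolding n_def using ex by (rule LeastI_ex)
  have least: "n \<le> m" if "(e, e') \<in> R ^^ m" for m
    unfolding n_def using that by (rule Least_le)
  have "n > 0"
    using n ne by (cases n) auto
  from n obtain f where f0: "f 0 = e" and fn: "f n = e'"
    and f: "\<And>i. i < n \<Longrightarrow> (f i, f (Suc i)) \<in> R"
    by (auto simp: relpow_fun_conv)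
  have f': "(f (Suc i), f i) \<in> R" if "i < n" for i
    using f[OF that] \<open>sym R\<close> by (auto dest: symD)
  have neq: "f i \<noteq> f (Suc (Suc i))" if i: "Suc i < n" for i
  proof
    assume eq: "f i = f (Suc (Suc i))"
    have "(e, f i) \<in> R ^^ i"
      unfolding relpow_fun_conv using f0 f i by (intro exI[of _ f]) auto
    moreover have "(f i, e') \<in> R ^^ (n - Suc (Suc i))"
    proof -
      have "Suc (Suc (n - Suc (Suc i) + i)) = n" using i by simp
      then show ?thesis unfolding relpow_fun_conv
      using f fn i eq by (intro exI[of _ "\<lambda>j. f (Suc (Suc (j + i)))"]) auto
    qed
    ultimately have "(e, e') \<in> R ^^ (i + (n - Suc (Suc i)))"
      by (auto simp: relpow_add)
    from least[OF this] i show False by auto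
  qed
  have "R\<^sup>* `` {e} \<subseteq> f ` {..n}"
  proof (rule rtrancl_image_subset)
    show "e \<in> f ` {..n}" using f0 by (intro image_eqI[of _ _ 0]) auto
    fix u v assume "u \<in> f ` {..n}" and uv: "(u, v) \<in> R"
    then obtain i where i: "i \<le> n" and u: "u = f i" by auto
    consider "i = 0" | "i = n" | j where "i = Suc j" "Suc j < n"
      using i by (metis le_neq_implies_less old.nat.exhaust)
    then show "v \<in> f ` {..n}"
    proof cases
      case 1
      then have "v = f 1"
        using e uv u f0 f[OF \<open>n > 0\<close>] by (auto simp: ray_end_def)
      then show ?thesis using \<open>n > 0\<close> by auto
    next
      case 2
      then have "v = f (n - 1)"
        using e' uv u fn f'[of "n - 1"] \<open>n > 0\<close> by auto
      then show ?thesis by auto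
    next
      case 3
      then have "v = f j \<or> v = f (Suc (Suc j))"
        using max_degree_2D[OF deg _ _ neq, of "f i" j v] f'[of j] f[of "Suc j"] uv u by auto
      then show ?thesis using 3 by auto
    qed
  qed
  then have "finite (R\<^sup>* `` {e})"
    by (rule finite_subset) auto
  with e show False by (simp add: ray_end_def)
qed

text \<open>In an infinite component without ends, each vertex \<open>s\<close> has two neighbours, and after removal of \<open>s\<close>
  one of them, \<open>a\<close>, still has an infinite component. The other one, \<open>b\<close>, is not in it, since
  otherwise \<open>a\<close> and \<open>b\<close> would be two ends of the same component of the remaining graph.\<close>

lemma infinite_component_obtains_branch:
  assumes deg: "max_degree_2 R" and "sym R" and irr: "\<And>x. (x, x) \<notin> R"
    and inf: "infinite (R\<^sup>* `` {s})"
    and no_end: "\<And>x. (s, x) \<in> R\<^sup>* \<Longrightarrow> \<not> ray_end R x"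
  obtains a b where "(s, a) \<in> R" "(s, b) \<in> R" "a \<noteq> b"
    "infinite ((R - {s} \<times> UNIV - UNIV \<times> {s})\<^sup>* `` {a})"
    "(a, b) \<notin> (R - {s} \<times> UNIV - UNIV \<times> {s})\<^sup>*"
proof -
  let ?Q = "R - {s} \<times> UNIV - UNIV \<times> {s}"
  from no_end[of s] inf obtain a b where ab: "(s, a) \<in> R" "(s, b) \<in> R" "a \<noteq> b"
    by (auto simp: ray_end_def)
  have degQ: "max_degree_2 ?Q" and symQ: "sym ?Q"
    using deg \<open>sym R\<close> by (auto simp: max_degree_2_def sym_def)
  have "R\<^sup>* `` {s} \<subseteq> {s} \<union> ?Q\<^sup>* `` {a} \<union> ?Q\<^sup>* `` {b}"
  proof (rule rtrancl_image_subset)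
    fix u v assume u: "u \<in> {s} \<union> ?Q\<^sup>* `` {a} \<union> ?Q\<^sup>* `` {b}" and uv: "(u, v) \<in> R"
    show "v \<in> {s} \<union> ?Q\<^sup>* `` {a} \<union> ?Q\<^sup>* `` {b}"
    proof (cases "u = s \<or> v = s")
      case True
      then show ?thesis
        using max_degree_2D[OF deg ab, of v] uv by auto
    next
      case False
      then have "(u, v) \<in> ?Q" using uv by auto
      then show ?thesis using u False by (auto intro: rtrancl_into_rtrancl)
    qed
  qed auto
  then have "infinite (?Q\<^sup>* `` {a}) \<or> infinite (?Q\<^sup>* `` {b})"
    using inf by (meson finite.emptyI finite.insertI finite_UnI finite_subset)
  moreover have lone: "x = y" if "(s, c) \<in> R" "(c, x) \<in> ?Q" "(c, y) \<in> ?Q" for c x y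
  proof -
    have "(c, s) \<in> R" using that \<open>sym R\<close> by (auto dest: symD)
    then show ?thesis using that deg unfolding max_degree_2_def by blast
  qed
  ultimately have "(a, b) \<notin> ?Q\<^sup>*"
  proof -
    assume "infinite (?Q\<^sup>* `` {a}) \<or> infinite (?Q\<^sup>* `` {b})"
    moreover have "(b, a) \<in> ?Q\<^sup>*" if "(a, b) \<in> ?Q\<^sup>*"
      using that symQ by (metis sym_rtrancl symD)
    ultimately show ?thesis
      using ray_end_unique[OF degQ symQ, of a b] ray_end_unique[OF degQ symQ, of b a] 
        lone ab unfolding ray_end_def by metis
  qed
  moreover from this have "(b, a) \<notin> ?Q\<^sup>*"
    using symQ by (metis sym_rtrancl symD)
  ultimately show ?thesis
    using that ab \<open>infinite (?Q\<^sup>* `` {a}) \<or> infinite (?Q\<^sup>* `` {b})\<close> by metis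
qed

text \<open>An edge-drawing rule that assigns to each vertex set a graph with degrees at most two. Deleting
  vertices never destroys an edge between surviving vertices. The last assumption is a competition
  property: if \<open>a\<close> is a neighbour of \<open>s\<close>, then only finitely many other points can become neighbours
  of \<open>s\<close> in any subconfiguration that keeps \<open>a\<close>.\<close>

locale prunable_rule =
  fixes G :: "'v set \<Rightarrow> ('v \<times> 'v) set"
  assumes edges_subset: "G S \<subseteq> S \<times> S"
    and edges_sym: "sym (G S)"
    and edges_irrefl: "(s, s) \<notin> G S"
    and edges_max_degree_2: "max_degree_2 (G S)"
    and edges_preserved: "(s, t) \<in> G S \<Longrightarrow> S' \<subseteq> S \<Longrightarrow> s \<in> S' \<Longrightarrow> t \<in> S' \<Longrightarrow> (s, t) \<in> G S'"
    and finitely_many_competitors: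
      "(a, s) \<in> G S \<Longrightarrow> finite {w \<in> S. \<exists>S'\<subseteq>S. a \<in> S' \<and> w \<noteq> a \<and> (w, s) \<in> G S'}"
begin

text \<open>Deleting a suitable finite set of vertices turns an infinite component into one with an end. In
  a component without ends, follow the infinite branch \<open>W\<close> from \<open>s\<close> through \<open>a\<close> and
  delete the finitely many competitors of \<open>a\<close> at \<open>s\<close> outside \<open>W\<close>. New edges may appear, but none at \<open>s\<close>:
  a new neighbour would have to lie in \<open>W\<close>, where every vertex other than \<open>a\<close> keeps two old neighbours.\<close>

lemma exists_pruning:
  assumes "s \<in> S" and inf: "infinite ((G S)\<^sup>* `` {s})"
  shows "\<exists>F. finite F \<and> F \<subseteq> S \<and> (\<exists>e\<in>S - F. ray_end (G (S - F)) e)"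
proof (cases "\<exists>x. (s, x) \<in> (G S)\<^sup>* \<and> ray_end (G S) x")
  case True
  then obtain x where x: "(s, x) \<in> (G S)\<^sup>*" "ray_end (G S) x" by blast
  have "x \<in> S"
    using rtrancl_image_subset[of s S "G S"] \<open>s \<in> S\<close> x(1) edges_subset by blast
  then show ?thesis using x by (intro exI[of _ "{}"]) auto
next
  case False
  let ?R = "G S" and ?Q = "G S - {s} \<times> UNIV - UNIV \<times> {s}"
  have deg: "max_degree_2 ?R" by (rule edges_max_degree_2)
  obtain a b where ab: "(s, a) \<in> ?R" "(s, b) \<in> ?R" "a \<noteq> b"
    and infa: "infinite (?Q\<^sup>* `` {a})" and nab: "(a, b) \<notin> ?Q\<^sup>*"
    using infinite_component_obtains_branch[OF deg edges_sym edges_irrefl inf] False by metis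
  have symE: "(y, x) \<in> G T" if "(x, y) \<in> G T" for x y T
    using edges_sym that by (auto dest: symD)
  define W where "W = ?Q\<^sup>* `` {a}"
  have aW: "a \<in> W" and bW: "b \<notin> W" using nab by (auto simp: W_def)
  have sW: "s \<notin> W"
  proof
    assume "s \<in> W"
    then have "(a, s) \<in> ?Q\<^sup>*" by (simp add: W_def)
    then show False using ab edges_irrefl by (cases rule: rtranclE) auto
  qed
  have WS: "W \<subseteq> S"
    unfolding W_def by (rule rtrancl_image_subset) (use edges_subset ab in auto)
  have closed: "v \<in> W" if "u \<in> W" "(u, v) \<in> ?R" "v \<noteq> s" for u v
    using that sW unfolding W_def
    by (metis (no_types, lifting) DiffI Image_singleton_iff SigmaE2 rtrancl.rtrancl_into_rtrancl singletonD)
  have reachW: "(s, u) \<in> ?R\<^sup>*" if "u \<in> W" for u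
  proof -
    have "(a, u) \<in> ?R\<^sup>*" using that rtrancl_mono[of ?Q ?R] by (auto simp: W_def)
    then show ?thesis using ab(1) by (meson converse_rtrancl_into_rtrancl)
  qed
  define C where "C = {w \<in> S. \<exists>S'\<subseteq>S. a \<in> S' \<and> w \<noteq> a \<and> (w, s) \<in> G S'}"
  define F where "F = C - W - {s}"
  let ?S = "S - F"
  have finF: "finite F"
    unfolding F_def C_def using finitely_many_competitors[of a s S] symE[OF ab(1)] by auto
  have "F \<subseteq> S" by (auto simp: F_def C_def)
  have WS': "W \<subseteq> ?S" and sS': "s \<in> ?S"
    using WS \<open>s \<in> S\<close> by (auto simp: F_def)
  have kept: "(u, v) \<in> G ?S" if "(u, v) \<in> ?R" "u \<in> insert s W" "v \<in> insert s W" for u v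
    by (rule edges_preserved[OF that(1)]) (use that WS' sS' in auto)
  have lone: "w = a" if w: "(s, w) \<in> G ?S" for w
  proof (rule ccontr)
    assume "w \<noteq> a"
    have wS: "w \<in> ?S" using w edges_subset by auto
    have "w \<in> C"
      unfolding C_def using wS WS' aW \<open>w \<noteq> a\<close> symE[OF w] by auto
    then have "w \<in> W"
      using wS w edges_irrefl[of s ?S] by (auto simp: F_def)
    have inf_w: "infinite (?R\<^sup>* `` {w})"
    proof -
      have "(w, s) \<in> ?R\<^sup>*"
        using reachW[OF \<open>w \<in> W\<close>] edges_sym[of S] by (metis sym_rtrancl symD)
      then have "?R\<^sup>* `` {s} \<subseteq> ?R\<^sup>* `` {w}" by (auto intro: rtrancl_trans)
      then show ?thesis using inf finite_subset by blast
    qed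
    \<comment> \<open>In the original graph \<open>w\<close> already has two neighbours, both in \<open>W\<close>; with \<open>s\<close> it would get a third.\<close>
    from False reachW[OF \<open>w \<in> W\<close>] inf_w
    obtain u v where uv: "(w, u) \<in> ?R" "(w, v) \<in> ?R" "u \<noteq> v"
      unfolding ray_end_def by metis
    have "(w, s) \<notin> ?R"
      using max_degree_2D[OF deg ab, of w] symE[of w s S] \<open>w \<noteq> a\<close> \<open>w \<in> W\<close> bW by blast
    then have us: "u \<noteq> s" "v \<noteq> s" using uv by auto
    then have "u \<in> W" "v \<in> W" using closed[OF \<open>w \<in> W\<close>] uv by auto
    then have "(w, u) \<in> G ?S" "(w, v) \<in> G ?S" using kept uv \<open>w \<in> W\<close> by auto
    then show False
      using max_degree_2D[OF edges_max_degree_2, of w u ?S v s] uv(3) us symE[OF w] by auto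
  qed
  have "W \<subseteq> (G ?S)\<^sup>* `` {s}"
  proof
    fix u assume "u \<in> W"
    then have "(a, u) \<in> ?Q\<^sup>*" by (simp add: W_def)
    then show "u \<in> (G ?S)\<^sup>* `` {s}"
    proof (induction rule: rtrancl_induct)
      case base
      then show ?case using kept[OF ab(1)] aW by auto
    next
      case (step y z)
      have "y \<in> W" "z \<in> W"
        using step.hyps by (auto simp: W_def intro: rtrancl_into_rtrancl)
      then have "(y, z) \<in> G ?S" using kept step.hyps by auto
      then show ?case using step.IH by (auto intro: rtrancl_into_rtrancl)
    qed
  qed
  then have "infinite ((G ?S)\<^sup>* `` {s})"
    using infa finite_subset by (fastforce simp: W_def)
  with lone have "ray_end (G ?S) s"
    by (auto simp: ray_end_def)
  then show ?thesis
    using finF \<open>F \<subseteq> S\<close> sS' by blast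
qed

end

section \<open>Configurations of marked points\<close>

text \<open>Marked points are pairs of a location and a nonnegative mark.\<close>

abbreviation point_space :: "('a::euclidean_space \<times> real) measure" where
  "point_space \<equiv> borel \<Otimes>\<^sub>M mark_space"

text \<open>The measurable sets of marked points that are bounded in the location coordinate, so that locally
  finite configurations have finitely many points in them.\<close>

definition windows :: "('a::euclidean_space \<times> real) set set" where
  "windows = {B \<in> sets point_space. bounded (fst ` B)}"

text \<open>Locally finite and simple configurations: no two points share a location. Simplicity allows a
  configuration to be represented as a set rather than as a counting measure.\<close>

definition configurations :: "('a::euclidean_space \<times> real) set set" where
  "configurations = {S. S \<subseteq> space point_space \<and> inj_on fst S \<and>
     (\<forall>B. bounded B \<longrightarrow> finite {s \<in> S. fst s \<in> B})}"

text \<open>Events that prescribe the numbers of points in finitely many windows, which need not be disjoint.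
  They form an intersection-stable generator.\<close>

definition count_events :: "('a::euclidean_space \<times> real) set set set" where
  "count_events =
    {{S \<in> configurations. \<forall>B\<in>J. card (S \<inter> B) = k B} | J k. finite J \<and> J \<subseteq> windows}"

definition configuration_algebra :: "('a::euclidean_space \<times> real) set measure" where
  "configuration_algebra = sigma configurations count_events"

lemma space_point_space: "space point_space = UNIV \<times> {0..}"
  by (simp add: space_pair_measure)

lemma count_events_Pow: "count_events \<subseteq> Pow configurations"
  by (auto simp: count_events_def)

lemma space_configuration_algebra [simp]: "space configuration_algebra = configurations"
  unfolding configuration_algebra_def by (rule space_measure_of[OF count_events_Pow])

lemma sets_configuration_algebra: "sets configuration_algebra = sigma_sets configurations count_events"
  unfolding configuration_algebra_def by (rule sets_measure_of[OF count_events_Pow])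

lemma windowsI: "B \<in> sets point_space \<Longrightarrow> bounded (fst ` B) \<Longrightarrow> B \<in> windows"
  by (simp add: windows_def)

lemma windows_sets: "B \<in> windows \<Longrightarrow> B \<in> sets point_space"
  by (simp add: windows_def)

lemma windows_Int: "B \<in> windows \<Longrightarrow> C \<in> sets point_space \<Longrightarrow> B \<inter> C \<in> windows"
  by (auto simp: windows_def intro: bounded_subset)

lemma windows_Diff: "B \<in> windows \<Longrightarrow> C \<in> sets point_space \<Longrightarrow> B - C \<in> windows"
  by (auto simp: windows_def intro: bounded_subset)

lemma empty_window: "{} \<in> windows" by (simp add: windows_def)

lemma windows_UN: 
  assumes "finite T" "\<And>n. n \<in> T \<Longrightarrow> B n \<in> windows"
  shows "(\<Union>n\<in>T. B n) \<in> windows"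
  using assms by (auto simp: windows_def image_UN)

lemma configurations_empty: "{} \<in> configurations"
  by (simp add: configurations_def)

lemma configurations_subset: "S \<in> configurations \<Longrightarrow> S' \<subseteq> S \<Longrightarrow> S' \<in> configurations"
  unfolding configurations_def
proof safe
  fix B :: "'a set" assume "S' \<subseteq> S" "bounded B" "\<forall>B. bounded B \<longrightarrow> finite {s \<in> S. fst s \<in> B}"
  then have "finite {s \<in> S. fst s \<in> B}" by blast
  then show "finite {s \<in> S'. fst s \<in> B}" by (rule rev_finite_subset) (use \<open>S' \<subseteq> S\<close> in auto)
qed (auto intro: inj_on_subset)

lemma configurations_finite:
  assumes "S \<in> configurations" "bounded (fst ` B)"
  shows "finite (S \<inter> B)"
proof -
  have "finite {s \<in> S. fst s \<in> fst ` B}" using assms by (auto simp: configurations_def)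
  then show ?thesis by (rule rev_finite_subset) auto
qed

lemma configurations_finite_window: "S \<in> configurations \<Longrightarrow> B \<in> windows \<Longrightarrow> finite (S \<inter> B)"
  by (simp add: configurations_finite windows_def)

lemma configurations_snd: "S \<in> configurations \<Longrightarrow> s \<in> S \<Longrightarrow> 0 \<le> snd s"
  by (auto simp: configurations_def space_point_space)

lemma measurable_count [measurable]:
  assumes "B \<in> windows"
  shows "(\<lambda>S. card (S \<inter> B)) \<in> measurable configuration_algebra (count_space UNIV)"
proof -
  have "{S \<in> configurations. card (S \<inter> B) = k} \<in> sets configuration_algebra" for k
  proof -
    have "{S \<in> configurations. card (S \<inter> B) = k} \<in> count_events"
      unfolding count_events_def using assms
      by (intro CollectI exI[of _ "{B}"] exI[of _ "\<lambda>_. k"]) auto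
    then show ?thesis unfolding sets_configuration_algebra by blast
  qed
  then show ?thesis
    unfolding measurable_count_space_eq2_countable
    by (auto simp: vimage_def Int_def conj_commute)
qed

lemma measurable_into_configuration_algebra:
  fixes c :: "'w \<Rightarrow> ('b::euclidean_space \<times> real) set"
  assumes "\<And>\<omega>. \<omega> \<in> space M \<Longrightarrow> c \<omega> \<in> configurations"
    and m: "\<And>B. B \<in> windows \<Longrightarrow> (\<lambda>\<omega>. card (c \<omega> \<inter> B)) \<in> measurable M (count_space UNIV)"
  shows "c \<in> measurable M configuration_algebra"
proof (rule measurable_sigma_sets[OF sets_configuration_algebra count_events_Pow])
  show "c \<in> space M \<rightarrow> configurations" using assms by auto
  fix A :: "('b::euclidean_space \<times> real) set set" assume "A \<in> count_events"
  then obtain J k where J: "finite J" "J \<subseteq> windows"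
    and A: "A = {S \<in> configurations. \<forall>B\<in>J. card (S \<inter> B) = k B}"
    by (auto simp: count_events_def)
  have "c -` A \<inter> space M = {\<omega> \<in> space M. \<forall>B\<in>J. card (c \<omega> \<inter> B) = k B}"
    using assms(1) by (auto simp: A)
  also have "\<dots> \<in> sets M"
  proof (rule sets.sets_Collect_finite_All[OF _ J(1)])
    fix B assume "B \<in> J"
    then have "(\<lambda>\<omega>. card (c \<omega> \<inter> B)) \<in> measurable M (count_space UNIV)" using m J by auto
    from measurable_sets[OF this, of "{k B}"]
    show "{\<omega> \<in> space M. card (c \<omega> \<inter> B) = k B} \<in> sets M"
      by (simp add: vimage_def Int_def conj_commute)
  qed
  finally show "c -` A \<inter> space M \<in> sets M" .
qed


lemma Int_stable_count_events: "Int_stable count_events"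
proof (rule Int_stableI)
  fix A A' :: "('a::euclidean_space \<times> real) set set" assume "A \<in> count_events" "A' \<in> count_events"
  then obtain J k J' k' where J: "finite J" "J \<subseteq> windows" "finite J'" "J' \<subseteq> windows"
    and A: "A = {S \<in> configurations. \<forall>B\<in>J. card (S \<inter> B) = k B}"
      "A' = {S \<in> configurations. \<forall>B\<in>J'. card (S \<inter> B) = k' B}"
    by (auto simp: count_events_def)
  show "A \<inter> A' \<in> count_events"
  proof (cases "\<forall>B\<in>J \<inter> J'. k B = k' B")
    case True
    then have "A \<inter> A' = {S \<in> configurations. \<forall>B\<in>J \<union> J'. card (S \<inter> B) = (if B \<in> J then k B else k' B)}"
      unfolding A by auto
    then show ?thesis
      unfolding count_events_def using J
      by (intro CollectI exI[of _ "J \<union> J'"] exI[of _ "\<lambda>B. if B \<in> J then k B else k' B"]) auto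
  next
    case False
    \<comment> \<open>The intersection is empty, hence the event that the empty window holds one point.\<close>
    then have "A \<inter> A' = {S \<in> configurations. \<forall>B\<in>{{}}. card (S \<inter> B) = 1}"
      unfolding A by force
    then show ?thesis
      unfolding count_events_def using empty_window
      by (intro CollectI exI[of _ "{{}}"] exI[of _ "\<lambda>_. 1"]) auto
  qed
qed

text \<open>The witness \<open>D\<close> consists of the nonempty atoms, inside the union of \<open>J\<close>, of the Boolean algebra
  generated by \<open>J\<close>.\<close>

lemma windows_atoms:
  fixes J :: "('a::euclidean_space \<times> real) set set"
  assumes "finite J" "J \<subseteq> windows"
  obtains D where "finite D" "D \<subseteq> windows" "disjoint D" "\<And>B. B \<in> J \<Longrightarrow> B = \<Union>{C \<in> D. C \<subseteq> B}"
proof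
  define atm where "atm x = {y. \<forall>B\<in>J. y \<in> B \<longleftrightarrow> x \<in> B}" for x :: "'a \<times> real"
  have self: "x \<in> atm x" for x by (simp add: atm_def)
  have atm_eq: "atm x = atm y" if "y \<in> atm x" for x y using that by (auto simp: atm_def)
  show "finite (atm ` \<Union>J)"
  proof (rule finite_subset)
    show "atm ` \<Union>J \<subseteq> (\<lambda>T. {y. \<forall>B\<in>J. y \<in> B \<longleftrightarrow> B \<in> T}) ` Pow J"
    proof safe
      fix x B assume "x \<in> B" "B \<in> J"
      show "atm x \<in> (\<lambda>T. {y. \<forall>B\<in>J. y \<in> B \<longleftrightarrow> B \<in> T}) ` Pow J"
        by (intro image_eqI[of _ _ "{B\<in>J. x \<in> B}"]) (auto simp: atm_def)
    qed
  qed (use assms in auto)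
  show "atm ` \<Union>J \<subseteq> windows"
  proof safe
    fix x B0 assume x: "x \<in> B0" "B0 \<in> J"
    have eq: "atm x = B0 \<inter> {y \<in> space point_space. \<forall>B\<in>J. y \<in> B \<longleftrightarrow> x \<in> B}"
      using x assms sets.sets_into_space[OF windows_sets] by (auto simp: atm_def)
    have "{y \<in> space point_space. \<forall>B\<in>J. y \<in> B \<longleftrightarrow> x \<in> B} \<in> sets point_space"
    proof (rule sets.sets_Collect_finite_All[OF _ assms(1)])
      fix B assume "B \<in> J"
      then have [measurable]: "B \<in> sets point_space" using assms windows_sets by auto
      show "{y \<in> space point_space. (y \<in> B) = (x \<in> B)} \<in> sets point_space"
        by measurable
    qed
    then show "atm x \<in> windows"
      unfolding eq using windows_Int x assms by blast
  qed
  show "disjoint (atm ` \<Union>J)"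
  proof (rule disjointI)
    fix C C' assume CC: "C \<in> atm ` \<Union>J" "C' \<in> atm ` \<Union>J" "C \<noteq> C'"
    then obtain x x' where "C = atm x" "C' = atm x'" by blast
    with CC(3) show "C \<inter> C' = {}" using atm_eq by blast
  qed
  show "B = \<Union>{C \<in> atm ` \<Union>J. C \<subseteq> B}" if "B \<in> J" for B
  proof
    show "B \<subseteq> \<Union>{C \<in> atm ` \<Union>J. C \<subseteq> B}"
    proof
      fix x assume "x \<in> B"
      then have "atm x \<in> {C \<in> atm ` \<Union>J. C \<subseteq> B}" using that by (auto simp: atm_def)
      then show "x \<in> \<Union>{C \<in> atm ` \<Union>J. C \<subseteq> B}" using self by blast
    qed
  qed auto
qed

text \<open>The law of a point process is determined by its counts in disjoint windows. Counts in
  arbitrary windows are sums of the counts in the atoms of these windows, so that a counting event is a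
  countable disjoint union of counting events for atoms.\<close>

lemma configuration_measure_eqI:
  fixes N1 N2 :: "('a::euclidean_space \<times> real) set measure"
  assumes N1: "sets N1 = sets configuration_algebra" and N2: "sets N2 = sets configuration_algebra"
    and fin: "emeasure N1 configurations \<noteq> \<infinity>"
    and eq: "\<And>n B k. (\<And>m. m < n \<Longrightarrow> B m \<in> windows) \<Longrightarrow> disjoint_family_on B {..<n} \<Longrightarrow>
      emeasure N1 {S \<in> configurations. \<forall>m<(n::nat). card (S \<inter> B m) = k m} =
      emeasure N2 {S \<in> configurations. \<forall>m<n. card (S \<inter> B m) = k m}"
  shows "N1 = N2"
proof (rule measure_eqI_generator_eq[where A = "\<lambda>_. configurations"])
  have dis: "emeasure N1 {S \<in> configurations. \<forall>C\<in>D. card (S \<inter> C) = k C} =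
      emeasure N2 {S \<in> configurations. \<forall>C\<in>D. card (S \<inter> C) = k C}"
    if D: "finite D" "D \<subseteq> windows" "disjoint D" for D k
  proof -
    obtain h where h: "bij_betw h {0..<card D} D"
      using ex_bij_betw_nat_finite[OF D(1)] by blast
    then have inj: "inj_on h {..<card D}" and hD: "D = h ` {..<card D}"
      unfolding bij_betw_def atLeast0LessThan by (rule conjunct1, rule conjunct2[THEN sym])
    have mem: "h m \<in> D" if "m < card D" for m
      by (subst hD, rule imageI) (use that in simp)
    have "disjoint_family_on h {..<card D}"
      unfolding disjoint_family_on_def
    proof (intro ballI impI)
      fix m m' assume m: "m \<in> {..<card D}" "m' \<in> {..<card D}" "m \<noteq> m'"
      then have "h m \<noteq> h m'" using inj by (meson inj_onD)
      then show "h m \<inter> h m' = {}" using mem m by (intro disjointD[OF D(3)]) simp_all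
    qed
    moreover have "h m \<in> windows" if "m < card D" for m
      using mem[OF that] D(2) by (rule rev_subsetD)
    moreover have "(\<forall>C\<in>D. card (S \<inter> C) = k C) \<longleftrightarrow> (\<forall>m<card D. card (S \<inter> h m) = k (h m))" for S
    proof
      show "\<forall>C\<in>D. card (S \<inter> C) = k C" if "\<forall>m<card D. card (S \<inter> h m) = k (h m)"
        by (subst hD) (use that in simp)
    qed (simp add: mem)
    ultimately show ?thesis using eq[of "card D" h "\<lambda>m. k (h m)"] by simp
  qed
  show "emeasure N1 A = emeasure N2 A" if event: "A \<in> count_events" for A
  proof -
    obtain J k where J: "finite J" "J \<subseteq> windows"
      and A: "A = {S \<in> configurations. \<forall>B\<in>J. card (S \<inter> B) = k B}"
      using event by (auto simp: count_events_def)
    obtain D where D: "finite D" "D \<subseteq> windows" "disjoint D"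
      and at: "\<And>B. B \<in> J \<Longrightarrow> B = \<Union>{C \<in> D. C \<subseteq> B}"
      using windows_atoms[OF J] by blast
    have sum: "card (S \<inter> B) = (\<Sum>C\<in>{C \<in> D. C \<subseteq> B}. card (S \<inter> C))"
      if "S \<in> configurations" "B \<in> J" for S B
    proof -
      have "S \<inter> B = (\<Union>C\<in>{C \<in> D. C \<subseteq> B}. S \<inter> C)" using at[OF that(2)] by blast
      also have "card \<dots> = (\<Sum>C\<in>{C \<in> D. C \<subseteq> B}. card (S \<inter> C))"
        using D that by (intro card_UN_disjoint ballI impI)
          (auto intro!: configurations_finite_window dest: disjointD)
      finally show ?thesis .
    qed
    \<comment> \<open>\<open>K\<close> collects the possible counts in the atoms; \<open>Z\<close> is the event that a given family of counts occurs.\<close>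
    define K where "K = {k'\<in>D \<rightarrow>\<^sub>E (UNIV :: nat set). \<forall>B\<in>J. (\<Sum>C\<in>{C \<in> D. C \<subseteq> B}. k' C) = k B}"
    define Z where "Z k' = {S \<in> configurations. \<forall>C\<in>D. card (S \<inter> C) = k' C}" for k' :: "_ \<Rightarrow> nat"
    have "countable K"
      by (rule countable_subset[OF _ countable_PiE[OF D(1)]]) (auto simp: K_def)
    have "A = (\<Union>k'\<in>K. Z k')"
    proof
      show "A \<subseteq> (\<Union>k'\<in>K. Z k')"
      proof
        fix S assume S: "S \<in> A"
        have "restrict (\<lambda>C. card (S \<inter> C)) D \<in> K"
          unfolding K_def
        proof (intro CollectI conjI ballI)
          fix B assume "B \<in> J"
          then show "(\<Sum>C\<in>{C \<in> D. C \<subseteq> B}. restrict (\<lambda>C. card (S \<inter> C)) D C) = k B"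
            using sum[of S B] S by (auto simp: A)
        qed auto
        moreover have "S \<in> Z (restrict (\<lambda>C. card (S \<inter> C)) D)"
          using S by (auto simp: Z_def A)
        ultimately show "S \<in> (\<Union>k'\<in>K. Z k')" by blast
      qed
      show "(\<Union>k'\<in>K. Z k') \<subseteq> A"
      proof safe
        fix S k' assume k': "k' \<in> K" "S \<in> Z k'"
        have "card (S \<inter> B) = k B" if "B \<in> J" for B
        proof -
          have "card (S \<inter> B) = (\<Sum>C\<in>{C \<in> D. C \<subseteq> B}. card (S \<inter> C))"
            using sum that k' by (auto simp: Z_def)
          also have "\<dots> = (\<Sum>C\<in>{C \<in> D. C \<subseteq> B}. k' C)"
            using k' by (intro sum.cong) (auto simp: Z_def)
          finally show ?thesis using k' that by (auto simp: K_def)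
        qed
        then show "S \<in> A" using k' by (auto simp: A Z_def)
      qed
    qed
    moreover have "disjoint_family_on Z K"
      unfolding disjoint_family_on_def
    proof (intro ballI impI)
      fix k1 k2 assume k: "k1 \<in> K" "k2 \<in> K" "k1 \<noteq> k2"
      then obtain C where "C \<in> D" "k1 C \<noteq> k2 C"
        unfolding K_def by (metis (no_types, lifting) PiE_ext mem_Collect_eq)
      then show "Z k1 \<inter> Z k2 = {}" by (auto simp: Z_def)
    qed
    moreover have "Z k' \<in> sets configuration_algebra" for k'
      unfolding sets_configuration_algebra Z_def count_events_def using D by blast
    ultimately have "emeasure N A = (\<integral>\<^sup>+k'. emeasure N (Z k') \<partial>count_space K)"
      if "sets N = sets configuration_algebra" for N
      using emeasure_UN_countable[of K Z N] \<open>countable K\<close> that by auto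
    then show ?thesis
      using N1 N2 dis[OF D] by (simp add: Z_def)
  qed
  have "configurations = {S \<in> configurations. \<forall>B\<in>{}. card (S \<inter> B) = (0::nat)}" by simp
  then show "range (\<lambda>_::nat. configurations) \<subseteq> count_events"
    unfolding count_events_def by blast
qed (use N1 N2 fin Int_stable_count_events count_events_Pow in \<open>auto simp: sets_configuration_algebra\<close>)

section \<open>Measurable enumeration of a configuration\<close>

text \<open>A countable base of the topology that consists of bounded sets.\<close>

definition bounded_base :: "(nat \<Rightarrow> 'a::euclidean_space set) \<Rightarrow> bool" where
  "bounded_base V \<longleftrightarrow> (\<forall>n. open (V n) \<and> bounded (V n)) \<and>
     (\<forall>U x. open U \<longrightarrow> x \<in> U \<longrightarrow> (\<exists>n. x \<in> V n \<and> V n \<subseteq> U))"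

lemma bounded_base_exists: "\<exists>V :: nat \<Rightarrow> 'a::euclidean_space set. bounded_base V"
proof -
  obtain B :: "'a set set" where B: "countable B" "topological_basis B"
    using ex_countable_basis by blast
  define B' where "B' = insert {} {b \<in> B. bounded b}"
  have B': "countable B'" "B' \<noteq> {}" using B by (auto simp: B'_def)
  have "bounded_base (from_nat_into B')"
    unfolding bounded_base_def
  proof (intro conjI allI impI)
    fix n
    have "from_nat_into B' n \<in> B'" using B' by (simp add: from_nat_into)
    then show "open (from_nat_into B' n)" "bounded (from_nat_into B' n)"
      using topological_basis_open[OF B(2)] by (auto simp: B'_def)
  next
    fix U :: "'a set" and x assume "open U" "x \<in> U"
    then have "open (U \<inter> ball x 1)" "x \<in> U \<inter> ball x 1" by auto
    then obtain b where b: "b \<in> B" "x \<in> b" "b \<subseteq> U \<inter> ball x 1"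
      using topological_basisE[OF B(2)] by blast
    then have "b \<in> B'" using bounded_subset[OF bounded_ball] by (auto simp: B'_def)
    then obtain n where "from_nat_into B' n = b" using from_nat_into_surj[OF B'(1)] by blast
    then show "\<exists>n. x \<in> from_nat_into B' n \<and> from_nat_into B' n \<subseteq> U" using b by auto
  qed
  then show ?thesis by blast
qed

definition base_set :: "nat \<Rightarrow> 'a::euclidean_space set" where
  "base_set = (SOME V. bounded_base V)"

lemma bounded_base_base_set: "bounded_base base_set"
  unfolding base_set_def using bounded_base_exists by (rule someI_ex)

text \<open>The cells are the countably many windows over the members of a bounded base; they separate the
  points of a configuration.\<close>

definition cell :: "nat \<Rightarrow> ('a::euclidean_space \<times> real) set" where
  "cell n = base_set n \<times> {0..}"

lemma cell_windows: "cell n \<in> windows"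
proof (rule windowsI)
  have *: "open (base_set n :: 'a set)" "bounded (base_set n :: 'a set)"
    using bounded_base_base_set by (auto simp: bounded_base_def)
  show "(cell n :: ('a \<times> real) set) \<in> sets point_space"
    unfolding cell_def using *(1)
    by (intro pair_measureI) (auto simp: sets_restrict_space_iff)
  show "bounded (fst ` (cell n :: ('a \<times> real) set))"
    unfolding cell_def using *(2) by simp
qed

lemma cell_isolates:
  assumes S: "S \<in> configurations" and "s \<in> S"
  shows "\<exists>n. S \<inter> cell n = {s}"
proof -
  define Z where "Z = {t \<in> S. fst t \<in> ball (fst s) 1} - {s}"
  define U where "U = ball (fst s) 1 - fst ` Z"
  have "finite Z" using S by (auto simp: Z_def configurations_def)
  then have "open U" unfolding U_def by (intro open_Diff finite_imp_closed) auto
  have inj: "t = s" if "t \<in> S" "fst t = fst s" for t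
    using S that \<open>s \<in> S\<close> by (auto simp: configurations_def dest: inj_onD)
  then have "fst s \<in> U" by (auto simp: U_def Z_def)
  then obtain n where n: "fst s \<in> base_set n" "base_set n \<subseteq> U"
    using bounded_base_base_set \<open>open U\<close> unfolding bounded_base_def by blast
  have "0 \<le> snd s" using S \<open>s \<in> S\<close> by (rule configurations_snd)
  then have "s \<in> cell n" using n(1) by (cases s) (simp add: cell_def)
  moreover have "t = s" if "t \<in> S" "t \<in> cell n" for t
  proof -
    have "fst t \<in> U" using that n(2) by (auto simp: cell_def)
    then show ?thesis using \<open>t \<in> S\<close> unfolding U_def Z_def by blast
  qed
  ultimately have "S \<inter> cell n = {s}" using \<open>s \<in> S\<close> by blast
  then show ?thesis ..
qed

lemma cells_separate:
  assumes S: "S \<in> configurations" and F: "finite F" "F \<subseteq> S"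
  shows "\<exists>T. finite T \<and> S \<inter> (\<Union>n\<in>T. cell n) = F"
proof -
  obtain g where g: "\<And>s. s \<in> F \<Longrightarrow> S \<inter> cell (g s) = {s}"
    using cell_isolates[OF S] F by (metis subset_iff)
  have "S \<inter> (\<Union>n\<in>g ` F. cell n) = (\<Union>s\<in>F. S \<inter> cell (g s))" by auto
  also have "\<dots> = F" using g by auto
  finally show ?thesis using F by blast
qed

text \<open>If a cell contains exactly one point of \<open>S\<close>, this point; otherwise the arbitrary value \<open>(0, 0)\<close>.\<close>

definition lone_point :: "nat \<Rightarrow> ('a::euclidean_space \<times> real) set \<Rightarrow> 'a \<times> real" where
  "lone_point n S = (if card (S \<inter> cell n) = 1 then the_elem (S \<inter> cell n) else (0, 0))"

text \<open>The number \<open>n\<close> is the label of a point if \<open>n\<close> is the first cell that contains this point and no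
  other one. Thus labels enumerate a configuration without repetition, and measurably in the
  counts.\<close>

definition is_label :: "nat \<Rightarrow> ('a::euclidean_space \<times> real) set \<Rightarrow> bool" where
  "is_label n S \<longleftrightarrow> card (S \<inter> cell n) = 1 \<and>
     (\<forall>m<n. card (S \<inter> cell m) = 1 \<longrightarrow> lone_point m S \<noteq> lone_point n S)"

lemma lone_point_eq: "S \<inter> cell n = {s} \<Longrightarrow> lone_point n S = s"
  by (simp add: lone_point_def)

lemma lone_point_mem: "card (S \<inter> cell n) = 1 \<Longrightarrow> lone_point n S \<in> S"
  using lone_point_eq[of S n] by (auto simp: card_1_singleton_iff)

lemma bij_betw_labels:
  assumes S: "S \<in> configurations"
  shows "bij_betw (\<lambda>n. lone_point n S) {n. is_label n S} S"
  unfolding bij_betw_def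
proof
  show "inj_on (\<lambda>n. lone_point n S) {n. is_label n S}"
    by (rule inj_onI) (metis is_label_def linorder_neqE_nat mem_Collect_eq)
  show "(\<lambda>n. lone_point n S) ` {n. is_label n S} = S"
  proof
    show "(\<lambda>n. lone_point n S) ` {n. is_label n S} \<subseteq> S"
      by (auto simp: is_label_def lone_point_mem)
    show "S \<subseteq> (\<lambda>n. lone_point n S) ` {n. is_label n S}"
    proof
      fix s assume "s \<in> S"
      \<comment> \<open>The label of \<open>s\<close> is the first cell in which it is alone.\<close>
      define n where "n = (LEAST n. card (S \<inter> cell n) = 1 \<and> lone_point n S = s)"
      obtain k where "S \<inter> cell k = {s}" using cell_isolates[OF S \<open>s \<in> S\<close>] by blast
      then have "card (S \<inter> cell k) = 1 \<and> lone_point k S = s" by (simp add: lone_point_eq)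
      then have n: "card (S \<inter> cell n) = 1 \<and> lone_point n S = s"
        unfolding n_def by (rule LeastI)
      moreover have "\<not> (card (S \<inter> cell m) = 1 \<and> lone_point m S = s)" if "m < n" for m
        using not_less_Least[OF that[unfolded n_def]] by simp
      ultimately have "is_label n S" by (auto simp: is_label_def)
      then show "s \<in> (\<lambda>n. lone_point n S) ` {n. is_label n S}" using n by auto
    qed
  qed
qed

lemma measurable_lone_point [measurable]:
  "lone_point n \<in> measurable configuration_algebra point_space"
proof (rule measurableI)
  fix S :: "('a \<times> real) set" assume "S \<in> space configuration_algebra"
  then show "lone_point n S \<in> space point_space"
    using lone_point_mem[of S n] by (auto simp: configurations_def lone_point_def space_point_space)
next
  fix B :: "('a \<times> real) set" assume B: "B \<in> sets point_space"
  have [measurable]: "cell n \<inter> B \<in> windows" "cell n \<in> windows"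
    using windows_Int[OF cell_windows B] cell_windows by auto
  have "lone_point n -` B \<inter> space configuration_algebra =
    {S \<in> space configuration_algebra. (card (S \<inter> cell n) = 1 \<and> card (S \<inter> (cell n \<inter> B)) = 1) \<or>
       (card (S \<inter> cell n) \<noteq> 1 \<and> (0, 0) \<in> B)}" (is "?A = ?B")
  proof (rule set_eqI)
    fix S :: "('a \<times> real) set"
    show "S \<in> ?A \<longleftrightarrow> S \<in> ?B"
    proof (cases "card (S \<inter> cell n) = 1")
      case True
      then obtain s where s: "S \<inter> cell n = {s}" by (auto simp: card_1_singleton_iff)
      then have "S \<inter> (cell n \<inter> B) = {s} \<inter> B" by auto
      then show ?thesis using s by (auto simp: lone_point_eq)
    qed (auto simp: lone_point_def)
  qed
  also have "\<dots> \<in> sets configuration_algebra" by measurable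
  finally show "lone_point n -` B \<inter> space configuration_algebra \<in> sets configuration_algebra" .
qed

lemma measurable_mark [measurable]: "snd \<in> borel_measurable point_space"
proof -
  have "(\<lambda>x. x) \<in> measurable mark_space borel" by (rule measurable_restrict_space1) simp
  from measurable_compose[OF measurable_snd this] show ?thesis .
qed

lemma pred_point_eq [measurable (raw)]:
  assumes [measurable]: "f \<in> measurable N point_space" "g \<in> measurable N point_space"
  shows "Measurable.pred N (\<lambda>x. f x = g x)"
proof -
  have "(f x = g x) \<longleftrightarrow> fst (f x) = fst (g x) \<and> snd (f x) = snd (g x)" for x
    by (auto simp: prod_eq_iff)
  then show ?thesis by simp
qed

lemma pred_is_label [measurable]: "Measurable.pred configuration_algebra (is_label n)"
proof -
  have [measurable]: "cell m \<in> windows" for m by (rule cell_windows)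
  show ?thesis unfolding is_label_def[abs_def] by measurable
qed

context
  fixes M :: "'w measure" and c :: "'w \<Rightarrow> ('a::euclidean_space \<times> real) set"
  assumes c [measurable]: "c \<in> measurable M configuration_algebra"
begin

lemma random_configuration: "\<omega> \<in> space M \<Longrightarrow> c \<omega> \<in> configurations"
  using measurable_space[OF c] by simp

lemma measurable_point_predicate:
  assumes [measurable]: "Measurable.pred (M \<Otimes>\<^sub>M point_space) (\<lambda>p. R (fst p) (snd p))"
  shows "Measurable.pred M (\<lambda>\<omega>. is_label n (c \<omega>) \<and> R \<omega> (lone_point n (c \<omega>)))"
proof -
  have "(\<lambda>\<omega>. (\<omega>, lone_point n (c \<omega>))) \<in> measurable M (M \<Otimes>\<^sub>M point_space)" by measurable
  from measurable_compose[OF this assms] have [measurable]: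
    "Measurable.pred M (\<lambda>\<omega>. R \<omega> (lone_point n (c \<omega>)))" by simp
  show ?thesis by measurable
qed

lemma pred_ex_point:
  assumes "Measurable.pred (M \<Otimes>\<^sub>M point_space) (\<lambda>p. R (fst p) (snd p))"
  shows "Measurable.pred M (\<lambda>\<omega>. \<exists>s\<in>c \<omega>. R \<omega> s)"
proof -
  note measurable_point_predicate[OF assms, measurable]
  have "(\<exists>s\<in>c \<omega>. R \<omega> s) \<longleftrightarrow> (\<exists>n. is_label n (c \<omega>) \<and> R \<omega> (lone_point n (c \<omega>)))"
    if "\<omega> \<in> space M" for \<omega>
    by (subst bij_betw_imp_surj_on[OF bij_betw_labels[OF random_configuration[OF that]], symmetric])
      simp
  moreover have "Measurable.pred M (\<lambda>\<omega>. \<exists>n. is_label n (c \<omega>) \<and> R \<omega> (lone_point n (c \<omega>)))"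
    by measurable
  ultimately show ?thesis by (rule iffD2[OF measurable_cong])
qed

lemma
  assumes "Measurable.pred (M \<Otimes>\<^sub>M point_space) (\<lambda>p. R (fst p) (snd p))"
  shows measurable_card_points: "(\<lambda>\<omega>. card {s \<in> c \<omega>. R \<omega> s}) \<in> measurable M (count_space UNIV)"
    and pred_infinite_points: "Measurable.pred M (\<lambda>\<omega>. infinite {s \<in> c \<omega>. R \<omega> s})"
proof -
  note measurable_point_predicate[OF assms, measurable]
  let ?L = "\<lambda>\<omega>. {n. is_label n (c \<omega>) \<and> R \<omega> (lone_point n (c \<omega>))}"
  have bij: "bij_betw (\<lambda>n. lone_point n (c \<omega>)) (?L \<omega>) {s \<in> c \<omega>. R \<omega> s}"
    if "\<omega> \<in> space M" for \<omega>
  proof -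
    note b = bij_betw_labels[OF random_configuration[OF that]]
    have "{s \<in> c \<omega>. R \<omega> s} = {s \<in> (\<lambda>n. lone_point n (c \<omega>)) ` {n. is_label n (c \<omega>)}. R \<omega> s}"
      by (simp add: bij_betw_imp_surj_on[OF b])
    also have "\<dots> = (\<lambda>n. lone_point n (c \<omega>)) ` ?L \<omega>" by auto
    finally show ?thesis
      using inj_on_subset[OF bij_betw_imp_inj_on[OF b], of "?L \<omega>"] by (auto simp: bij_betw_def)
  qed
  have "(\<lambda>\<omega>. card (?L \<omega>)) \<in> measurable M (count_space UNIV)" by measurable
  then show "(\<lambda>\<omega>. card {s \<in> c \<omega>. R \<omega> s}) \<in> measurable M (count_space UNIV)"
    by (rule iffD1[OF measurable_cong, rotated]) (rule bij_betw_same_card[OF bij])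
  have "(\<forall>m. \<exists>n>m. n \<in> ?L \<omega>) \<longleftrightarrow> infinite {s \<in> c \<omega>. R \<omega> s}" if "\<omega> \<in> space M" for \<omega>
    using infinite_nat_iff_unbounded[of "?L \<omega>"] bij_betw_finite[OF bij[OF that]] by argo
  moreover have "Measurable.pred M (\<lambda>\<omega>. \<forall>m. \<exists>n>m. n \<in> ?L \<omega>)" by measurable
  ultimately show "Measurable.pred M (\<lambda>\<omega>. infinite {s \<in> c \<omega>. R \<omega> s})"
    by (rule iffD1[OF measurable_cong])
qed

lemma measurable_infsum_points:
  fixes h :: "'w \<Rightarrow> 'a \<times> real \<Rightarrow> ennreal"
  assumes h: "(\<lambda>p. h (fst p) (snd p)) \<in> borel_measurable (M \<Otimes>\<^sub>M point_space)"
  shows "(\<lambda>\<omega>. infsum (h \<omega>) (c \<omega>)) \<in> borel_measurable M"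
proof -
  have "(\<lambda>\<omega>. (\<omega>, lone_point n (c \<omega>))) \<in> measurable M (M \<Otimes>\<^sub>M point_space)" for n by measurable
  from measurable_compose[OF this h] have [measurable]:
    "(\<lambda>\<omega>. h \<omega> (lone_point n (c \<omega>))) \<in> borel_measurable M" for n by simp
  have "infsum (h \<omega>) (c \<omega>) =
    (\<Sum>n. if is_label n (c \<omega>) then h \<omega> (lone_point n (c \<omega>)) else 0)" if "\<omega> \<in> space M" for \<omega>
  proof -
    have "infsum (h \<omega>) (c \<omega>) = infsum (\<lambda>n. h \<omega> (lone_point n (c \<omega>))) {n. is_label n (c \<omega>)}"
      using infsum_reindex_bij_betw[OF bij_betw_labels[OF random_configuration[OF that]], of "h \<omega>"]
      by simp
    also have "\<dots> = infsum (\<lambda>n. if is_label n (c \<omega>) then h \<omega> (lone_point n (c \<omega>)) else 0) UNIV"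
      by (rule infsum_cong_neutral) auto
    also have "\<dots> = (\<Sum>n. if is_label n (c \<omega>) then h \<omega> (lone_point n (c \<omega>)) else 0)"
      by (rule sums_unique[OF has_sum_imp_sums[OF has_sum_infsum]])
        (rule nonneg_summable_on_complete, simp)
    finally show ?thesis .
  qed
  moreover have "(\<lambda>\<omega>. \<Sum>n. if is_label n (c \<omega>) then h \<omega> (lone_point n (c \<omega>)) else 0)
      \<in> borel_measurable M"
    by measurable
  ultimately show ?thesis by (rule iffD2[OF measurable_cong])
qed

end

section \<open>Translations and the integer lattice\<close>

text \<open>Translation of the location; the mark is unchanged.\<close>

definition translate :: "'a::euclidean_space \<Rightarrow> 'a \<times> real \<Rightarrow> 'a \<times> real" where
  "translate v s = (v + fst s, snd s)"

lemma fst_translate [simp]: "fst (translate v s) = v + fst s"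
  and snd_translate [simp]: "snd (translate v s) = snd s"
  by (simp_all add: translate_def)

lemma translate_minus [simp]: "translate (- v) (translate v s) = s" "translate v (translate (- v) s) = s"
  by (simp_all add: translate_def)

lemma inj_translate: "inj (translate v)"
  by (rule inj_on_inverseI[of _ "translate (- v)"]) simp

lemma translate_image_minus [simp]: "translate (- v) ` translate v ` S = S"
  by (simp add: image_image)

lemma measurable_translate [measurable]: "translate v \<in> measurable point_space point_space"
proof -
  have "(\<lambda>s. (v + fst s, snd s)) \<in> measurable point_space point_space" by measurable
  then show ?thesis by (simp add: translate_def[abs_def])
qed

lemma translate_vimage_windows:
  assumes "B \<in> windows"
  shows "{s \<in> space point_space. translate v s \<in> B} \<in> windows"
proof (rule windowsI)
  show "{s \<in> space point_space. translate v s \<in> B} \<in> sets point_space"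
    using windows_sets[OF assms] by measurable
  have "fst ` {s \<in> space point_space. translate v s \<in> B} \<subseteq> (\<lambda>x. - v + x) ` fst ` B"
  proof safe
    fix a b assume "translate v (a, b) \<in> B"
    then show "fst (a, b) \<in> (\<lambda>x. - v + x) ` fst ` B"
      by (intro image_eqI[of _ _ "v + a"] image_eqI[of _ _ "translate v (a, b)"]) auto
  qed
  moreover have "bounded ((\<lambda>x. - v + x) ` fst ` B)"
    using assms by (intro bounded_translation) (simp add: windows_def)
  ultimately show "bounded (fst ` {s \<in> space point_space. translate v s \<in> B})"
    by (rule bounded_subset[rotated])
qed

lemma translate_configurations:
  assumes S: "S \<in> configurations"
  shows "translate v ` S \<in> configurations"
  unfolding configurations_def
proof (intro CollectI conjI allI impI)
  show "translate v ` S \<subseteq> space point_space"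
    using S by (auto simp: configurations_def space_point_space translate_def)
  show "inj_on fst (translate v ` S)"
  proof (rule inj_onI)
    fix x y assume "x \<in> translate v ` S" "y \<in> translate v ` S" "fst x = fst y"
    then obtain x' y' where "x = translate v x'" "y = translate v y'" "x' \<in> S" "y' \<in> S" "fst x' = fst y'"
      by (elim imageE) simp
    then show "x = y" using S by (auto simp: configurations_def dest: inj_onD)
  qed
  fix B :: "'a set" assume "bounded B"
  then have "bounded ((\<lambda>x. - v + x) ` B)" by (rule bounded_translation)
  then have "finite {s \<in> S. fst s \<in> (\<lambda>x. - v + x) ` B}"
    using S by (simp add: configurations_def)
  moreover have "{s \<in> translate v ` S. fst s \<in> B} \<subseteq> translate v ` {s \<in> S. fst s \<in> (\<lambda>x. - v + x) ` B}"
  proof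
    fix t assume "t \<in> {s \<in> translate v ` S. fst s \<in> B}"
    then obtain s where s: "t = translate v s" "s \<in> S" "fst (translate v s) \<in> B" by blast
    then have "fst s \<in> (\<lambda>x. - v + x) ` B" by (intro image_eqI[of _ _ "fst (translate v s)"]) auto
    then show "t \<in> translate v ` {s \<in> S. fst s \<in> (\<lambda>x. - v + x) ` B}" using s by blast
  qed
  ultimately show "finite {s \<in> translate v ` S. fst s \<in> B}"
    by (meson finite_imageI finite_subset)
qed

lemma card_translate_Int:
  assumes "S \<in> configurations"
  shows "card (translate v ` S \<inter> B) = card (S \<inter> {s \<in> space point_space. translate v s \<in> B})"
proof -
  have "translate v ` S \<inter> B = translate v ` (S \<inter> {s \<in> space point_space. translate v s \<in> B})"
    using assms by (auto simp: configurations_def)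
  then show ?thesis by (simp add: card_image inj_on_subset[OF inj_translate])
qed

lemma measurable_translate_image [measurable]:
  "(\<lambda>S. translate v ` S) \<in> measurable configuration_algebra configuration_algebra"
proof (rule measurable_into_configuration_algebra)
  fix B :: "('a \<times> real) set" assume "B \<in> windows"
  then have "(\<lambda>S. card (S \<inter> {s \<in> space point_space. translate v s \<in> B}))
      \<in> measurable configuration_algebra (count_space UNIV)"
    by (intro measurable_count translate_vimage_windows)
  then show "(\<lambda>S. card (translate v ` S \<inter> B)) \<in> measurable configuration_algebra (count_space UNIV)"
    by (rule iffD2[OF measurable_cong, rotated]) (simp add: card_translate_Int)
qed (simp add: translate_configurations)

text \<open>Half-open unit cubes; their translates by the integer lattice partition the space.\<close>

definition cube :: "'a::euclidean_space \<Rightarrow> 'a set" where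
  "cube z = {x. \<forall>b\<in>Basis. - (1/2) \<le> (x - z) \<bullet> b \<and> (x - z) \<bullet> b < 1/2}"

definition integer_lattice :: "'a::euclidean_space set" where
  "integer_lattice = {z. \<forall>b\<in>Basis. z \<bullet> b \<in> \<int>}"

lemma cube_translate: "v + x \<in> cube (v + z) \<longleftrightarrow> x \<in> cube z"
  by (simp add: cube_def)

lemma sets_cube [measurable]: "cube z \<in> sets borel"
  unfolding cube_def by measurable

lemma cube_0_subset: "cube 0 \<subseteq> unit_cube"
  by (auto simp: cube_def unit_cube_def mem_box less_imp_le)

lemma bounded_cube: "bounded (cube z)"
proof -
  have "cube z \<subseteq> (\<lambda>x. z + x) ` cbox ((- 1 / 2) *\<^sub>R One) ((1 / 2) *\<^sub>R One)"
  proof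
    fix x assume "x \<in> cube z"
    then show "x \<in> (\<lambda>x. z + x) ` cbox ((- 1 / 2) *\<^sub>R One) ((1 / 2) *\<^sub>R One)"
      by (intro image_eqI[of _ _ "x - z"]) (auto simp: cube_def mem_box less_imp_le)
  qed
  then show ?thesis
    by (rule bounded_subset[OF bounded_translation[OF bounded_cbox]])
qed

lemma cube_window: "cube z \<times> {0..} \<in> windows"
  by (intro windowsI pair_measureI) (auto simp: sets_restrict_space_iff bounded_cube)

lemma cubes_cover: "\<exists>z\<in>integer_lattice. x \<in> cube z"
proof
  define z where "z = (\<Sum>b\<in>Basis. of_int \<lfloor>x \<bullet> b + 1/2\<rfloor> *\<^sub>R b)"
  have z: "z \<bullet> b = of_int \<lfloor>x \<bullet> b + 1/2\<rfloor>" if "b \<in> Basis" for b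
    using that by (simp add: z_def inner_sum_left inner_Basis if_distrib sum.delta cong: if_cong)
  then show "z \<in> integer_lattice" by (auto simp: integer_lattice_def)
  show "x \<in> cube z"
    unfolding cube_def
  proof (intro CollectI ballI)
    fix b :: 'a assume "b \<in> Basis"
    then show "- (1/2) \<le> (x - z) \<bullet> b \<and> (x - z) \<bullet> b < 1/2"
      by (simp add: inner_diff_left z) linarith
  qed
qed

lemma cubes_disjoint:
  assumes z: "z \<in> integer_lattice" "w \<in> integer_lattice" and x: "x \<in> cube z" "x \<in> cube w"
  shows "z = w"
proof (rule euclidean_eqI)
  fix b :: 'a assume b: "b \<in> Basis"
  then obtain m n where mn: "z \<bullet> b = of_int m" "w \<bullet> b = of_int n"
    using z unfolding integer_lattice_def by (metis (mono_tags, lifting) Ints_cases mem_Collect_eq)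
  have "\<bar>z \<bullet> b - w \<bullet> b\<bar> < 1"
    using x b by (auto simp: cube_def inner_diff_left abs_less_iff dest!: bspec[of _ _ b])
  then have "\<bar>real_of_int (m - n)\<bar> < 1" by (simp add: mn)
  then have "m = n" by linarith
  then show "z \<bullet> b = w \<bullet> b" by (simp add: mn)
qed

lemma countable_integer_lattice: "countable (integer_lattice :: 'a::euclidean_space set)"
proof (rule countable_subset)
  show "integer_lattice \<subseteq> (\<lambda>f. \<Sum>b\<in>Basis. of_int (f b) *\<^sub>R (b::'a)) ` (Basis \<rightarrow>\<^sub>E (UNIV :: int set))"
  proof
    fix z :: 'a assume z: "z \<in> integer_lattice"
    have "z = (\<Sum>b\<in>Basis. of_int (restrict (\<lambda>b. \<lfloor>z \<bullet> b\<rfloor>) Basis b) *\<^sub>R b)"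
      using z by (subst euclidean_representation[of z, symmetric])
        (intro sum.cong, auto simp: integer_lattice_def elim!: Ints_cases)
    then show "z \<in> (\<lambda>f. \<Sum>b\<in>Basis. of_int (f b) *\<^sub>R (b::'a)) ` (Basis \<rightarrow>\<^sub>E (UNIV :: int set))"
      by (intro image_eqI[of _ _ "restrict (\<lambda>b. \<lfloor>z \<bullet> b\<rfloor>) Basis"]) simp_all
  qed
qed (intro countable_image countable_PiE, auto)

lemma integer_lattice_diff: "z \<in> integer_lattice \<Longrightarrow> w \<in> integer_lattice \<Longrightarrow> w - z \<in> integer_lattice"
  by (auto simp: integer_lattice_def inner_diff_left)

section \<open>Mass transport\<close>

text \<open>An edge-drawing rule as above on marked point configurations that is moreover measurable and
  covariant under translations.\<close>

locale edge_rule = prunable_rule G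
  for G :: "('a::euclidean_space \<times> real) set \<Rightarrow> (('a \<times> real) \<times> ('a \<times> real)) set" +
  assumes measurable_edges [measurable]:
      "Measurable.pred (configuration_algebra \<Otimes>\<^sub>M (point_space \<Otimes>\<^sub>M point_space)) (\<lambda>p. snd p \<in> G (fst p))"
    and edges_translate: "S \<in> configurations \<Longrightarrow> (s, t) \<in> G S \<Longrightarrow>
      (translate v s, translate v t) \<in> G (translate v ` S)"
begin

abbreviation edge_space where
  "edge_space \<equiv> configuration_algebra \<Otimes>\<^sub>M (point_space \<Otimes>\<^sub>M point_space) ::
    (('a \<times> real) set \<times> ('a \<times> real) \<times> ('a \<times> real)) measure"

lemma measurable_relpow: "Measurable.pred edge_space (\<lambda>p. snd p \<in> G (fst p) ^^ k)"
proof (induction k)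
  case 0
  have "snd p \<in> G (fst p) ^^ 0 \<longleftrightarrow> fst (snd p) = snd (snd p)" for p :: "('a \<times> real) set \<times> ('a \<times> real) \<times> ('a \<times> real)"
    by (cases p) auto
  moreover have "Measurable.pred edge_space (\<lambda>p. fst (snd p) = snd (snd p))" by measurable
  ultimately show ?case by simp
next
  case (Suc k)
  have "(\<lambda>q. (fst (fst q), (fst (snd (fst q)), snd q))) \<in> measurable (edge_space \<Otimes>\<^sub>M point_space) edge_space"
    by measurable
  from measurable_compose[OF this Suc.IH]
  have [measurable]: "Measurable.pred (edge_space \<Otimes>\<^sub>M point_space)
    (\<lambda>q. (fst (snd (fst q)), snd q) \<in> G (fst (fst q)) ^^ k)" by simp
  have "(\<lambda>q. (fst (fst q), (snd q, snd (snd (fst q))))) \<in> measurable (edge_space \<Otimes>\<^sub>M point_space) edge_space"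
    by measurable
  from measurable_compose[OF this measurable_edges]
  have [measurable]: "Measurable.pred (edge_space \<Otimes>\<^sub>M point_space)
    (\<lambda>q. (snd q, snd (snd (fst q))) \<in> G (fst (fst q)))" by simp
  have "Measurable.pred edge_space
    (\<lambda>p. \<exists>u\<in>fst p. (fst (snd p), u) \<in> G (fst p) ^^ k \<and> (u, snd (snd p)) \<in> G (fst p))"
    by (rule pred_ex_point) measurable
  moreover have "snd p \<in> G (fst p) ^^ Suc k \<longleftrightarrow>
      (\<exists>u\<in>fst p. (fst (snd p), u) \<in> G (fst p) ^^ k \<and> (u, snd (snd p)) \<in> G (fst p))"
    for p :: "('a \<times> real) set \<times> ('a \<times> real) \<times> ('a \<times> real)"
    using edges_subset[of "fst p"] by (cases p) (auto simp: relcomp_unfold)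
  ultimately show ?case by simp
qed

lemma measurable_reach [measurable]: "Measurable.pred edge_space (\<lambda>p. snd p \<in> (G (fst p))\<^sup>*)"
proof -
  note measurable_relpow [measurable]
  show ?thesis by (simp add: rtrancl_is_UN_relpow)
qed

lemma measurable_ray_end [measurable]:
  "Measurable.pred (configuration_algebra \<Otimes>\<^sub>M point_space) (\<lambda>p. ray_end (G (fst p)) (snd p))"
proof -
  let ?N = "configuration_algebra \<Otimes>\<^sub>M point_space :: (('a \<times> real) set \<times> ('a \<times> real)) measure"
  have "(\<lambda>q. (fst (fst q), (snd (fst q), snd q))) \<in> measurable (?N \<Otimes>\<^sub>M point_space) edge_space"
    by measurable
  from measurable_compose[OF this measurable_edges] measurable_compose[OF this measurable_reach]
  have [measurable]: "Measurable.pred (?N \<Otimes>\<^sub>M point_space) (\<lambda>q. (snd (fst q), snd q) \<in> G (fst (fst q)))"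
    "Measurable.pred (?N \<Otimes>\<^sub>M point_space) (\<lambda>q. (snd (fst q), snd q) \<in> (G (fst (fst q)))\<^sup>*)"
    by simp_all
  have "(\<lambda>q. (fst (fst (fst q)), (snd (fst (fst q)), snd (fst q))))
      \<in> measurable ((?N \<Otimes>\<^sub>M point_space) \<Otimes>\<^sub>M point_space) edge_space"
    by measurable
  from measurable_compose[OF this measurable_edges]
  have [measurable]: "Measurable.pred ((?N \<Otimes>\<^sub>M point_space) \<Otimes>\<^sub>M point_space)
    (\<lambda>q. (snd (fst (fst q)), snd (fst q)) \<in> G (fst (fst (fst q))))" by simp
  have "(\<lambda>q. (fst (fst (fst q)), (snd (fst (fst q)), snd q)))
      \<in> measurable ((?N \<Otimes>\<^sub>M point_space) \<Otimes>\<^sub>M point_space) edge_space"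
    by measurable
  from measurable_compose[OF this measurable_edges]
  have [measurable]: "Measurable.pred ((?N \<Otimes>\<^sub>M point_space) \<Otimes>\<^sub>M point_space)
    (\<lambda>q. (snd (fst (fst q)), snd q) \<in> G (fst (fst (fst q))))" by simp
  have "Measurable.pred (?N \<Otimes>\<^sub>M point_space)
      (\<lambda>q. \<exists>b\<in>fst (fst q). (snd (fst q), snd q) \<in> G (fst (fst q)) \<and> (snd (fst q), b) \<in> G (fst (fst q)) \<and> snd q \<noteq> b)"
    by (rule pred_ex_point) measurable
  then have [measurable]: "Measurable.pred ?N
      (\<lambda>p. \<exists>a\<in>fst p. \<exists>b\<in>fst p. (snd p, a) \<in> G (fst p) \<and> (snd p, b) \<in> G (fst p) \<and> a \<noteq> b)"
    by (intro pred_ex_point) measurable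
  have [measurable]: "Measurable.pred ?N (\<lambda>p. infinite {t \<in> fst p. (snd p, t) \<in> (G (fst p))\<^sup>*})"
    by (rule pred_infinite_points) measurable
  have "infinite ((G S)\<^sup>* `` {e}) \<longleftrightarrow> infinite {t \<in> S. (e, t) \<in> (G S)\<^sup>*}" for S e
  proof -
    have "(G S)\<^sup>* `` {e} \<subseteq> insert e {t \<in> S. (e, t) \<in> (G S)\<^sup>*}"
      using edges_subset[of S] by (auto elim: rtranclE)
    moreover have "{t \<in> S. (e, t) \<in> (G S)\<^sup>*} \<subseteq> (G S)\<^sup>* `` {e}" by auto
    ultimately show ?thesis by (meson finite.insertI finite_subset)
  qed
  then have eq: "ray_end (G (fst p)) (snd p) \<longleftrightarrow>
      \<not> (\<exists>a\<in>fst p. \<exists>b\<in>fst p. (snd p, a) \<in> G (fst p) \<and> (snd p, b) \<in> G (fst p) \<and> a \<noteq> b) \<and>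
      infinite {t \<in> fst p. (snd p, t) \<in> (G (fst p))\<^sup>*}" for p
    unfolding ray_end_def using edges_subset[of "fst p"] by blast
  show ?thesis by (simp only: eq) measurable
qed

text \<open>Some component is a one-sided infinite path.\<close>

definition has_ray_end :: "('a \<times> real) set \<Rightarrow> bool" where
  "has_ray_end S \<longleftrightarrow> (\<exists>e\<in>S. ray_end (G S) e)"

lemma measurable_has_ray_end [measurable]: "Measurable.pred configuration_algebra has_ray_end"
  unfolding has_ray_end_def[abs_def] by (rule pred_ex_point) measurable

text \<open>The mass sent from the cube at \<open>z\<close> to the cube at \<open>w\<close>: each point of an infinite component with
  an end sends unit mass to this end, and the points of the cube at \<open>z\<close> whose mass arrives in the cube
  at \<open>w\<close> are collected.\<close>

definition mass :: "'a \<Rightarrow> 'a \<Rightarrow> ('a \<times> real) set \<Rightarrow> ('a \<times> real) set" where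
  "mass z w S = {s \<in> S. fst s \<in> cube z \<and>
     (\<exists>e\<in>S. fst e \<in> cube w \<and> ray_end (G S) e \<and> (e, s) \<in> (G S)\<^sup>*)}"

lemma measurable_card_mass:
  "(\<lambda>S. card (mass z w S)) \<in> measurable configuration_algebra (count_space UNIV)"
  unfolding mass_def
proof (rule measurable_card_points)
  let ?N = "configuration_algebra \<Otimes>\<^sub>M point_space :: (('a \<times> real) set \<times> ('a \<times> real)) measure"
  have "(\<lambda>q. (fst (fst q), (snd q, snd (fst q)))) \<in> measurable (?N \<Otimes>\<^sub>M point_space) edge_space"
    by measurable
  from measurable_compose[OF this measurable_reach]
  have [measurable]: "Measurable.pred (?N \<Otimes>\<^sub>M point_space) (\<lambda>q. (snd q, snd (fst q)) \<in> (G (fst (fst q)))\<^sup>*)"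
    by simp
  have "(\<lambda>q. (fst (fst q), snd q)) \<in> measurable (?N \<Otimes>\<^sub>M point_space) ?N" by measurable
  from measurable_compose[OF this measurable_ray_end]
  have [measurable]: "Measurable.pred (?N \<Otimes>\<^sub>M point_space) (\<lambda>q. ray_end (G (fst (fst q))) (snd q))"
    by simp
  have [measurable]: "Measurable.pred ?N
      (\<lambda>p. \<exists>e\<in>fst p. fst e \<in> cube w \<and> ray_end (G (fst p)) e \<and> (e, snd p) \<in> (G (fst p))\<^sup>*)"
    by (rule pred_ex_point) measurable
  show "Measurable.pred ?N (\<lambda>p. fst (snd p) \<in> cube z \<and>
      (\<exists>e\<in>fst p. fst e \<in> cube w \<and> ray_end (G (fst p)) e \<and> (e, snd p) \<in> (G (fst p))\<^sup>*))"
    by measurable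
qed measurable

lemma edges_translate_iff:
  assumes S: "S \<in> configurations"
  shows "(translate v s, translate v t) \<in> G (translate v ` S) \<longleftrightarrow> (s, t) \<in> G S"
  using edges_translate[OF S, of s t v]
    edges_translate[OF translate_configurations[OF S], of "translate v s" "translate v t" v "- v"]
  by auto

lemma reach_translate:
  assumes S: "S \<in> configurations" and "(s, t) \<in> (G S)\<^sup>*"
  shows "(translate v s, translate v t) \<in> (G (translate v ` S))\<^sup>*"
  using assms(2)
  by (induction rule: rtrancl_induct) (auto intro: rtrancl_into_rtrancl edges_translate[OF S])

lemma reach_translate_iff:
  assumes S: "S \<in> configurations"
  shows "(translate v s, translate v t) \<in> (G (translate v ` S))\<^sup>* \<longleftrightarrow> (s, t) \<in> (G S)\<^sup>*"
  using reach_translate[OF S, of s t v]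
    reach_translate[OF translate_configurations[OF S], of "translate v s" "translate v t" v "- v"]
  by auto

lemma ray_end_translate:
  assumes S: "S \<in> configurations" and e: "ray_end (G S) e"
  shows "ray_end (G (translate v ` S)) (translate v e)"
  unfolding ray_end_def
proof (intro conjI allI impI)
  fix a b assume ab: "(translate v e, a) \<in> G (translate v ` S) \<and> (translate v e, b) \<in> G (translate v ` S)"
  then have "a \<in> translate v ` S" "b \<in> translate v ` S"
    using edges_subset[of "translate v ` S"] by blast+
  then obtain a' b' where "a = translate v a'" "b = translate v b'" by blast
  then have "(e, a') \<in> G S" "(e, b') \<in> G S" using ab by (auto simp: edges_translate_iff[OF S])
  then have "a' = b'" using e unfolding ray_end_def by blast
  then show "a = b" using \<open>a = translate v a'\<close> \<open>b = translate v b'\<close> by simp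
next
  have "translate v ` ((G S)\<^sup>* `` {e}) \<subseteq> (G (translate v ` S))\<^sup>* `` {translate v e}"
    using reach_translate[OF S] by auto
  moreover have "infinite (translate v ` ((G S)\<^sup>* `` {e}))"
    using e finite_imageD[OF _ inj_on_subset[OF inj_translate]] by (auto simp: ray_end_def)
  ultimately show "infinite ((G (translate v ` S))\<^sup>* `` {translate v e})"
    using finite_subset by blast
qed

lemma ray_end_translate_iff:
  assumes S: "S \<in> configurations"
  shows "ray_end (G (translate v ` S)) (translate v e) \<longleftrightarrow> ray_end (G S) e"
  using ray_end_translate[OF S, of e v]
    ray_end_translate[OF translate_configurations[OF S], of v "translate v e" "- v"]
  by auto

lemma card_mass_translate:
  assumes S: "S \<in> configurations"
  shows "card (mass (v + z) (v + w) (translate v ` S)) = card (mass z w S)"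
proof -
  have "mass (v + z) (v + w) (translate v ` S) = translate v ` mass z w S"
  proof -
    have "translate v s \<in> mass (v + z) (v + w) (translate v ` S) \<longleftrightarrow> s \<in> mass z w S" for s
      unfolding mass_def
      by (simp add: cube_translate ray_end_translate_iff[OF S] reach_translate_iff[OF S]
          inj_image_mem_iff[OF inj_translate])
    moreover have "mass (v + z) (v + w) (translate v ` S) \<subseteq> translate v ` S"
      unfolding mass_def by blast
    ultimately show ?thesis by blast
  qed
  then show ?thesis by (simp add: card_image inj_on_subset[OF inj_translate])
qed

lemma finite_mass: "S \<in> configurations \<Longrightarrow> finite (mass z w S)"
  by (rule finite_subset[OF _ configurations_finite_window[OF _ cube_window[of z]]])
    (auto simp: mass_def configurations_def space_point_space)

lemma ray_end_unique_in_component: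
  assumes "ray_end (G S) e" "ray_end (G S) e'" "(e, s) \<in> (G S)\<^sup>*" "(e', s) \<in> (G S)\<^sup>*"
  shows "e = e'"
proof (rule ray_end_unique[OF edges_max_degree_2 edges_sym assms(1)])
  have "(s, e') \<in> (G S)\<^sup>*" using assms(4) edges_sym[of S] by (metis sym_rtrancl symD)
  then show "(e, e') \<in> (G S)\<^sup>*" using assms(3) by (rule rtrancl_trans[rotated])
qed (use assms(2) in \<open>auto simp: ray_end_def\<close>)

lemma mass_sent:
  assumes S: "S \<in> configurations"
  shows "(\<integral>\<^sup>+w. of_nat (card (mass z w S)) \<partial>count_space integer_lattice)
    \<le> of_nat (card (S \<inter> cube z \<times> {0..}))"
proof -
  let ?C = "count_space (UNIV :: ('a \<times> real) set)"
  have dis: "disjoint_family_on (\<lambda>w. mass z w S) integer_lattice"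
    unfolding disjoint_family_on_def
  proof (intro ballI impI)
    fix w w' :: 'a assume w: "w \<in> integer_lattice" "w' \<in> integer_lattice" "w \<noteq> w'"
    show "mass z w S \<inter> mass z w' S = {}"
    proof (rule ccontr)
      assume "mass z w S \<inter> mass z w' S \<noteq> {}"
      then obtain s e e' where "fst e \<in> cube w" "ray_end (G S) e" "(e, s) \<in> (G S)\<^sup>*"
        "fst e' \<in> cube w'" "ray_end (G S) e'" "(e', s) \<in> (G S)\<^sup>*"
        unfolding mass_def by blast
      with w show False using ray_end_unique_in_component cubes_disjoint by metis
    qed
  qed
  have "(\<integral>\<^sup>+w. of_nat (card (mass z w S)) \<partial>count_space integer_lattice)
      = (\<integral>\<^sup>+w. emeasure ?C (mass z w S) \<partial>count_space integer_lattice)"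
    by (simp add: finite_mass[OF S])
  also have "\<dots> = emeasure ?C (\<Union>w\<in>integer_lattice. mass z w S)"
    using countable_integer_lattice dis by (subst emeasure_UN_countable) auto
  also have "\<dots> \<le> emeasure ?C (S \<inter> cube z \<times> {0..})"
    using S by (intro emeasure_mono) (auto simp: mass_def configurations_def space_point_space)
  also have "\<dots> = of_nat (card (S \<inter> cube z \<times> {0..}))"
    using configurations_finite_window[OF S cube_window] by simp
  finally show ?thesis .
qed

lemma mass_received:
  assumes S: "S \<in> configurations" and e: "e \<in> S" "fst e \<in> cube w" "ray_end (G S) e"
  shows "(\<integral>\<^sup>+z. of_nat (card (mass z w S)) \<partial>count_space integer_lattice) = \<infinity>"
proof -
  let ?C = "count_space (UNIV :: ('a \<times> real) set)"
  have "(\<integral>\<^sup>+z. of_nat (card (mass z w S)) \<partial>count_space integer_lattice)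
      = (\<integral>\<^sup>+z. emeasure ?C (mass z w S) \<partial>count_space integer_lattice)"
    by (simp add: finite_mass[OF S])
  also have "\<dots> = emeasure ?C (\<Union>z\<in>integer_lattice. mass z w S)"
    using countable_integer_lattice
    by (subst emeasure_UN_countable)
      (auto simp: disjoint_family_on_def mass_def dest: cubes_disjoint)
  also have "\<dots> = \<infinity>"
  proof -
    have "(G S)\<^sup>* `` {e} \<subseteq> S"
      using rtrancl_image_subset[of e S "G S"] e(1) edges_subset[of S] by blast
    then have "(G S)\<^sup>* `` {e} \<subseteq> (\<Union>z\<in>integer_lattice. mass z w S)"
      using cubes_cover e unfolding mass_def by blast
    moreover have "infinite ((G S)\<^sup>* `` {e})" using e by (simp add: ray_end_def)
    ultimately have "infinite (\<Union>z\<in>integer_lattice. mass z w S)" using finite_subset by blast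
    then show ?thesis by simp
  qed
  finally show ?thesis .
qed

text \<open>Mass transport. By stationarity the expected mass received by a cube equals the expected mass
  sent by a cube. The latter is at most the intensity, which is finite, while a cube that contains an
  end receives infinite mass.\<close>

lemma no_ray_end_if_stationary:
  assumes sets_N: "sets N = sets configuration_algebra"
    and stationary: "\<And>v. distr N configuration_algebra (\<lambda>S. translate v ` S) = N"
    and intensity: "(\<integral>\<^sup>+S. of_nat (card (S \<inter> cube 0 \<times> {0..})) \<partial>N) < \<infinity>"
  shows "AE S in N. \<not> has_ray_end S"
proof -
  have space_N: "space N = configurations"
    using sets_eq_imp_space_eq[OF sets_N] by simp
  define m where "m z w S = (of_nat (card (mass z w S)) :: ennreal)" for z w S
  have [measurable]: "m z w \<in> borel_measurable configuration_algebra" for z w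
    unfolding m_def using measurable_card_mass[of z w] by measurable
  have mN [measurable]: "m z w \<in> borel_measurable N" for z w
    by (simp add: measurable_cong_sets[OF sets_N refl])
  define E where "E z w = (\<integral>\<^sup>+S. m z w S \<partial>N)" for z w
  have E_translate: "E (v + z) (v + w) = E z w" for v z w
  proof -
    have "E (v + z) (v + w) = (\<integral>\<^sup>+S. m (v + z) (v + w) S \<partial>distr N configuration_algebra (\<lambda>S. translate v ` S))"
      by (simp add: E_def stationary)
    also have "\<dots> = (\<integral>\<^sup>+S. m (v + z) (v + w) (translate v ` S) \<partial>N)"
      by (rule nn_integral_distr) (simp_all add: measurable_cong_sets[OF sets_N refl] measurable_translate_image)
    also have "\<dots> = E z w"
      unfolding E_def by (rule nn_integral_cong) (simp add: m_def card_mass_translate space_N)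
    finally show ?thesis .
  qed
  \<comment> \<open>The total mass received by the cube at \<open>w\<close>.\<close>
  have total_mass_measurable:
    "(\<lambda>S. \<integral>\<^sup>+z. m z w S \<partial>count_space integer_lattice) \<in> borel_measurable N" for w
  proof -
    interpret sigma_finite_measure "count_space (integer_lattice :: 'a set)"
      by (rule sigma_finite_measure_count_space_countable[OF countable_integer_lattice])
    have "(\<lambda>p. m (fst p) w (snd p)) \<in> borel_measurable (count_space integer_lattice \<Otimes>\<^sub>M N)"
      by (rule measurable_pair_measure_countable1[OF countable_integer_lattice]) (simp add: mN)
    from measurable_compose[OF measurable_pair_swap' this]
    show ?thesis
      by (intro borel_measurable_nn_integral) (simp add: case_prod_beta')
  qed
  have "AE S in N. \<not> (\<exists>e\<in>S. fst e \<in> cube w \<and> ray_end (G S) e)" if w: "w \<in> integer_lattice" for w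
  proof -
    have bij: "bij_betw (\<lambda>z. w - z) integer_lattice integer_lattice"
      by (rule bij_betwI[of _ _ _ "\<lambda>z. w - z"]) (auto intro: integer_lattice_diff w)
    have "(\<integral>\<^sup>+S. \<integral>\<^sup>+z. m z w S \<partial>count_space integer_lattice \<partial>N) = (\<integral>\<^sup>+z. E z w \<partial>count_space integer_lattice)"
      unfolding E_def by (rule nn_integral_count_space_nn_integral) (simp_all add: countable_integer_lattice mN)
    also have "\<dots> = (\<integral>\<^sup>+z. E 0 (w - z) \<partial>count_space integer_lattice)"
      using E_translate[of _ 0] by (metis add.right_neutral add_diff_cancel_left' diff_add_cancel add.commute)
    also have "\<dots> = (\<integral>\<^sup>+z. E 0 z \<partial>count_space integer_lattice)"
      by (rule nn_integral_bij_count_space[OF bij])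
    also have "\<dots> = (\<integral>\<^sup>+S. \<integral>\<^sup>+z. m 0 z S \<partial>count_space integer_lattice \<partial>N)"
      unfolding E_def
      by (rule nn_integral_count_space_nn_integral[symmetric]) (simp_all add: countable_integer_lattice mN)
    also have "\<dots> \<le> (\<integral>\<^sup>+S. of_nat (card (S \<inter> cube 0 \<times> {0..})) \<partial>N)"
      unfolding m_def by (rule nn_integral_mono) (simp add: mass_sent space_N)
    also note intensity
    finally have "AE S in N. (\<integral>\<^sup>+z. m z w S \<partial>count_space integer_lattice) \<noteq> \<infinity>"
      by (intro nn_integral_PInf_AE total_mass_measurable) simp_all
    then show ?thesis
    proof (rule AE_mp, intro AE_I2 impI notI)
      fix S assume S: "S \<in> space N" and fin: "(\<integral>\<^sup>+z. m z w S \<partial>count_space integer_lattice) \<noteq> \<infinity>"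
        and "\<exists>e\<in>S. fst e \<in> cube w \<and> ray_end (G S) e"
      then obtain e where "e \<in> S" "fst e \<in> cube w" "ray_end (G S) e" by blast
      from mass_received[OF _ this] S fin show False by (simp add: m_def space_N)
    qed
  qed
  then have "AE S in N. \<forall>w\<in>integer_lattice. \<not> (\<exists>e\<in>S. fst e \<in> cube w \<and> ray_end (G S) e)"
    by (subst AE_ball_countable) (simp_all add: countable_integer_lattice)
  then show ?thesis
    by (rule AE_mp) (use cubes_cover in \<open>fastforce simp: has_ray_end_def intro: AE_I2\<close>)
qed

end

section \<open>The SINR graph\<close>

text \<open>The signal power that arrives at \<open>t\<close> from the transmitter \<open>s\<close>; a negative product, which does not
  occur for nonnegative marks and path loss, would be cut off at \<open>0\<close>.\<close>

definition received :: "(real \<Rightarrow> real) \<Rightarrow> 'a::euclidean_space \<times> real \<Rightarrow> 'a \<times> real \<Rightarrow> ennreal" where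
  "received ell s t = ennreal (snd s * ell (dist (fst s) (fst t)))"

text \<open>The signal from \<open>s\<close> exceeds at \<open>t\<close> the threshold given by noise and interference from the other
  points of \<open>S\<close>.\<close>

definition heard ::
  "real \<Rightarrow> real \<Rightarrow> (real \<Rightarrow> real) \<Rightarrow> real \<Rightarrow> ('a::euclidean_space \<times> real) set \<Rightarrow> 'a \<times> real \<Rightarrow> 'a \<times> real \<Rightarrow> bool" where
  "heard \<tau> N\<^sub>o ell \<gamma> S s t \<longleftrightarrow> ennreal \<tau> * (ennreal N\<^sub>o + ennreal \<gamma> * (\<Sum>\<^sub>\<infinity>u\<in>S - {s, t}. received ell u t))
     < received ell s t"

text \<open>The SINR graph of a configuration; in contrast to \<^const>\<open>sinr_edges\<close>, the vertices are the marked
  points themselves.\<close>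

definition sinr_graph ::
  "real \<Rightarrow> real \<Rightarrow> (real \<Rightarrow> real) \<Rightarrow> real \<Rightarrow> ('a::euclidean_space \<times> real) set \<Rightarrow> (('a \<times> real) \<times> ('a \<times> real)) set" where
  "sinr_graph \<tau> N\<^sub>o ell \<gamma> S =
    {(s, t). s \<in> S \<and> t \<in> S \<and> s \<noteq> t \<and> heard \<tau> N\<^sub>o ell \<gamma> S s t \<and> heard \<tau> N\<^sub>o ell \<gamma> S t s}"

lemma infsum_ennreal_mono_set:
  fixes f :: "'b \<Rightarrow> ennreal"
  assumes "A \<subseteq> B"
  shows "infsum f A \<le> infsum f B"
  by (rule infsum_mono_neutral) (use assms in \<open>auto intro: nonneg_summable_on_complete\<close>)

lemma heard_subset:
  assumes "heard \<tau> N\<^sub>o ell \<gamma> S s t" "S' \<subseteq> S"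
  shows "heard \<tau> N\<^sub>o ell \<gamma> S' s t"
proof -
  have "(\<Sum>\<^sub>\<infinity>u\<in>S' - {s, t}. received ell u t) \<le> (\<Sum>\<^sub>\<infinity>u\<in>S - {s, t}. received ell u t)"
    using assms(2) by (intro infsum_ennreal_mono_set) auto
  then have "ennreal \<tau> * (ennreal N\<^sub>o + ennreal \<gamma> * (\<Sum>\<^sub>\<infinity>u\<in>S' - {s, t}. received ell u t))
    \<le> ennreal \<tau> * (ennreal N\<^sub>o + ennreal \<gamma> * (\<Sum>\<^sub>\<infinity>u\<in>S - {s, t}. received ell u t))"
    by (intro mult_left_mono add_left_mono) auto
  then show ?thesis using assms(1) unfolding heard_def by (rule le_less_trans)
qed

lemma heard_interference:
  assumes "heard \<tau> N\<^sub>o ell \<gamma> S s t"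
  shows "ennreal \<tau> * (ennreal \<gamma> * (\<Sum>\<^sub>\<infinity>u\<in>S - {s, t}. received ell u t)) < received ell s t"
proof -
  have "ennreal \<tau> * (ennreal \<gamma> * (\<Sum>\<^sub>\<infinity>u\<in>S - {s, t}. received ell u t)) \<le>
    ennreal \<tau> * (ennreal N\<^sub>o + ennreal \<gamma> * (\<Sum>\<^sub>\<infinity>u\<in>S - {s, t}. received ell u t))"
    by (intro mult_left_mono) auto
  then show ?thesis using assms unfolding heard_def by (rule le_less_trans)
qed

lemma heard_dominates:
  assumes "heard \<tau> N\<^sub>o ell \<gamma> S s t" "finite F" "F \<subseteq> S - {s, t}"
  shows "ennreal \<tau> * (ennreal \<gamma> * (\<Sum>u\<in>F. received ell u t)) < received ell s t"
proof -
  have "(\<Sum>u\<in>F. received ell u t) \<le> (\<Sum>\<^sub>\<infinity>u\<in>S - {s, t}. received ell u t)"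
    using infsum_ennreal_mono_set[OF assms(3), of "\<lambda>u. received ell u t"] assms(2)
    by simp
  then have "ennreal \<tau> * (ennreal \<gamma> * (\<Sum>u\<in>F. received ell u t)) \<le>
    ennreal \<tau> * (ennreal \<gamma> * (\<Sum>\<^sub>\<infinity>u\<in>S - {s, t}. received ell u t))"
    by (intro mult_left_mono) auto
  then show ?thesis using heard_interference[OF assms(1)] by (rule le_less_trans)
qed

text \<open>If \<open>s\<close> had three neighbours, then the power received from each of them would exceed \<open>\<tau> \<gamma>\<close> times the
  sum of the other two, and adding up gives \<open>2 \<tau> \<gamma> < 1\<close>.\<close>

lemma sinr_graph_max_degree_2:
  assumes "\<tau> > 0" and "\<gamma> > 1 / (2 * \<tau>)"
  shows "max_degree_2 (sinr_graph \<tau> N\<^sub>o ell \<gamma> S)"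
  unfolding max_degree_2_def
proof (intro allI impI, elim conjE, rule ccontr)
  fix s a b c
  assume E: "(s, a) \<in> sinr_graph \<tau> N\<^sub>o ell \<gamma> S" "(s, b) \<in> sinr_graph \<tau> N\<^sub>o ell \<gamma> S"
      "(s, c) \<in> sinr_graph \<tau> N\<^sub>o ell \<gamma> S"
    and "\<not> (a = b \<or> a = c \<or> b = c)"
  then have ne: "a \<noteq> b" "a \<noteq> c" "b \<noteq> c" by auto
  have "0 < 1 / (2 * \<tau>)" using \<open>\<tau> > 0\<close> by simp
  then have "\<gamma> > 0" using assms(2) by linarith
  define r where "r u = max 0 (snd u * ell (dist (fst u) (fst s)))" for u
  have r: "received ell u s = ennreal (r u)" "0 \<le> r u" for u
    by (auto simp: received_def r_def max_def ennreal_neg)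
  have *: "\<tau> * (\<gamma> * (r y + r z)) < r x"
    if "(s, x) \<in> sinr_graph \<tau> N\<^sub>o ell \<gamma> S" "(s, y) \<in> sinr_graph \<tau> N\<^sub>o ell \<gamma> S"
      "(s, z) \<in> sinr_graph \<tau> N\<^sub>o ell \<gamma> S" "x \<noteq> y" "x \<noteq> z" "y \<noteq> z" for x y z
  proof -
    have "ennreal \<tau> * (ennreal \<gamma> * (\<Sum>u\<in>{y, z}. received ell u s)) < received ell x s"
      using that by (intro heard_dominates) (auto simp: sinr_graph_def)
    then have "ennreal (\<tau> * (\<gamma> * (r y + r z))) < ennreal (r x)"
      using \<open>\<tau> > 0\<close> \<open>\<gamma> > 0\<close> \<open>y \<noteq> z\<close> r(2)
      by (simp add: r ennreal_mult'' ennreal_plus add_nonneg_nonneg flip: ennreal_mult)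
    then show ?thesis using r(2)[of x] by (subst (asm) ennreal_less_iff) (auto simp: \<open>\<tau> > 0\<close> \<open>\<gamma> > 0\<close> less_imp_le r)
  qed
  let ?R = "r a + r b + r c"
  have "1 \<le> 2 * (\<tau> * \<gamma>)" using assms by (simp add: field_simps)
  then have "1 * ?R \<le> 2 * (\<tau> * \<gamma>) * ?R" using r(2) by (intro mult_right_mono) simp_all
  moreover have "2 * (\<tau> * \<gamma>) * ?R < ?R"
    using *[OF E(1,2,3)] *[OF E(2,1,3)] *[OF E(3,1,2)] ne by (simp add: algebra_simps)
  ultimately show False by simp
qed

text \<open>The interference at \<open>s\<close> against the edge from \<open>a\<close> is finite, so only finitely many points reach \<open>s\<close>
  with at least the power \<open>\<epsilon>\<close> that is needed to be heard there against \<open>a\<close>.\<close>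

lemma sinr_graph_finitely_many_competitors:
  assumes "\<tau> > 0" "\<gamma> > 0" and as: "(a, s) \<in> sinr_graph \<tau> N\<^sub>o ell \<gamma> S"
  shows "finite {w \<in> S. \<exists>S'\<subseteq>S. a \<in> S' \<and> w \<noteq> a \<and> (w, s) \<in> sinr_graph \<tau> N\<^sub>o ell \<gamma> S'}"
proof -
  define \<epsilon> where "\<epsilon> = ennreal \<tau> * (ennreal \<gamma> * received ell a s)"
  \<comment> \<open>In any subconfiguration that contains \<open>a\<close>, a transmitter heard at \<open>s\<close> must exceed \<open>\<epsilon>\<close>.\<close>
  define Z where "Z = {w \<in> S - {a, s}. \<epsilon> \<le> received ell w s}"
  have hd: "heard \<tau> N\<^sub>o ell \<gamma> S a s" using as by (simp add: sinr_graph_def)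
  have pos: "0 < received ell a s"
    using hd unfolding heard_def by (rule le_less_trans[OF zero_le])
  have "\<epsilon> > 0" using assms(1,2) pos by (simp add: \<epsilon>_def ennreal_zero_less_mult_iff)
  have "(\<Sum>\<^sub>\<infinity>u\<in>S - {a, s}. received ell u s) \<noteq> \<infinity>"
    using heard_interference[OF hd] assms(1,2) by (auto simp: ennreal_mult_top)
  have "finite Z"
  proof (rule ccontr)
    assume "infinite Z"
    then have "(\<Sum>\<^sub>\<infinity>u\<in>Z. received ell u s) = \<infinity>"
      using \<open>\<epsilon> > 0\<close> by (intro infsum_superconst_infinite_ennreal[of _ \<epsilon>]) (auto simp: Z_def)
    moreover have "(\<Sum>\<^sub>\<infinity>u\<in>Z. received ell u s) \<le> (\<Sum>\<^sub>\<infinity>u\<in>S - {a, s}. received ell u s)"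
      by (rule infsum_ennreal_mono_set) (auto simp: Z_def)
    ultimately show False
      using \<open>(\<Sum>\<^sub>\<infinity>u\<in>S - {a, s}. received ell u s) \<noteq> \<infinity>\<close> by (simp add: top_unique)
  qed
  moreover have "{w \<in> S. \<exists>S'\<subseteq>S. a \<in> S' \<and> w \<noteq> a \<and> (w, s) \<in> sinr_graph \<tau> N\<^sub>o ell \<gamma> S'} \<subseteq> Z"
  proof safe
    fix x p S' assume w: "(x, p) \<in> S" "S' \<subseteq> S" "a \<in> S'" "(x, p) \<noteq> a" "((x, p), s) \<in> sinr_graph \<tau> N\<^sub>o ell \<gamma> S'"
    then have "ennreal \<tau> * (ennreal \<gamma> * (\<Sum>u\<in>{a}. received ell u s)) < received ell (x, p) s"
      using as by (intro heard_dominates[where S = S']) (auto simp: sinr_graph_def)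
    then have "\<epsilon> \<le> received ell (x, p) s" by (simp add: \<epsilon>_def less_imp_le)
    moreover have "(x, p) \<noteq> s" using w(5) by (auto simp: sinr_graph_def)
    ultimately show "(x, p) \<in> Z" using w by (auto simp: Z_def)
  qed
  ultimately show ?thesis by (rule rev_finite_subset)
qed

lemma heard_translate:
  assumes "heard \<tau> N\<^sub>o ell \<gamma> S s t"
  shows "heard \<tau> N\<^sub>o ell \<gamma> (translate v ` S) (translate v s) (translate v t)"
proof -
  have eq: "translate v ` S - {translate v s, translate v t} = translate v ` (S - {s, t})"
    using image_set_diff[OF inj_translate, of v S "{s, t}"] by simp
  have rec: "received ell (translate v u) (translate v t) = received ell u t" for u
    by (simp add: received_def)
  have "(\<Sum>\<^sub>\<infinity>u\<in>translate v ` S - {translate v s, translate v t}. received ell u (translate v t))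
      = (\<Sum>\<^sub>\<infinity>u\<in>S - {s, t}. received ell u t)"
    unfolding eq by (subst infsum_reindex) (auto simp: inj_on_subset[OF inj_translate] rec o_def)
  then show ?thesis using assms by (simp add: heard_def rec)
qed

lemma measurable_received:
  fixes ell :: "real \<Rightarrow> real"
  assumes ell: "ell \<in> borel_measurable (restrict_space borel {0..})"
    and [measurable]: "f \<in> measurable N (point_space :: ('a::euclidean_space \<times> real) measure)"
      "g \<in> measurable N point_space"
  shows "(\<lambda>x. received ell (f x) (g x)) \<in> borel_measurable N"
proof -
  have "(\<lambda>x. dist (fst (f x)) (fst (g x))) \<in> measurable N (restrict_space borel {0..})"
    by (rule measurable_restrict_space2) auto
  from measurable_compose[OF this ell]
  have [measurable]: "(\<lambda>x. ell (dist (fst (f x)) (fst (g x)))) \<in> borel_measurable N" .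
  show ?thesis unfolding received_def by measurable
qed

lemma measurable_heard:
  assumes ell: "ell \<in> borel_measurable (restrict_space borel {0..})"
    and c [measurable]: "c \<in> measurable N configuration_algebra"
    and f [measurable]: "f \<in> measurable N (point_space :: ('a::euclidean_space \<times> real) measure)"
    and g [measurable]: "g \<in> measurable N point_space"
  shows "Measurable.pred N (\<lambda>x. heard \<tau> N\<^sub>o ell \<gamma> (c x) (f x) (g x))"
proof -
  note measurable_received[OF ell, measurable]
  define h where "h x u = (if u = f x \<or> u = g x then 0 else received ell u (g x))" for x u
  have "(\<lambda>p. h (fst p) (snd p)) \<in> borel_measurable (N \<Otimes>\<^sub>M point_space)"
    unfolding h_def by measurable
  then have [measurable]: "(\<lambda>x. infsum (h x) (c x)) \<in> borel_measurable N"
    by (rule measurable_infsum_points[OF c])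
  have "(\<Sum>\<^sub>\<infinity>u\<in>c x - {f x, g x}. received ell u (g x)) = infsum (h x) (c x)" for x
    by (rule infsum_cong_neutral) (auto simp: h_def)
  then show ?thesis unfolding heard_def by simp
qed

lemma edge_rule_sinr_graph:
  fixes ell :: "real \<Rightarrow> real"
  assumes ell: "ell \<in> borel_measurable (restrict_space borel {0..})"
    and "\<tau> > 0" and \<gamma>: "\<gamma> > 1 / (2 * \<tau>)"
  shows "edge_rule (sinr_graph \<tau> N\<^sub>o ell \<gamma> :: ('a::euclidean_space \<times> real) set \<Rightarrow> _)"
proof
  let ?G = "sinr_graph \<tau> N\<^sub>o ell \<gamma> :: ('a \<times> real) set \<Rightarrow> _"
  have "0 < 1 / (2 * \<tau>)" using \<open>\<tau> > 0\<close> by simp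
  then have "\<gamma> > 0" using \<gamma> by linarith
  show "max_degree_2 (?G S)" for S by (rule sinr_graph_max_degree_2[OF \<open>\<tau> > 0\<close> \<gamma>])
  show "finite {w \<in> S. \<exists>S'\<subseteq>S. a \<in> S' \<and> w \<noteq> a \<and> (w, s) \<in> ?G S'}" if "(a, s) \<in> ?G S" for a s S
    using that by (rule sinr_graph_finitely_many_competitors[OF \<open>\<tau> > 0\<close> \<open>\<gamma> > 0\<close>])
  show "(s, t) \<in> ?G S'" if "(s, t) \<in> ?G S" "S' \<subseteq> S" "s \<in> S'" "t \<in> S'" for s t S S'
    using that heard_subset unfolding sinr_graph_def by blast
  show "(translate v s, translate v t) \<in> ?G (translate v ` S)" if "(s, t) \<in> ?G S" for s t v S
    using that heard_translate[of \<tau> N\<^sub>o ell \<gamma> S] inj_translate[of v]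
    unfolding sinr_graph_def by (auto simp: inj_eq)
  show "Measurable.pred (configuration_algebra \<Otimes>\<^sub>M (point_space \<Otimes>\<^sub>M point_space)) (\<lambda>p. snd p \<in> ?G (fst p))"
  proof -
    let ?N = "configuration_algebra \<Otimes>\<^sub>M (point_space \<Otimes>\<^sub>M point_space) ::
      (('a \<times> real) set \<times> ('a \<times> real) \<times> ('a \<times> real)) measure"
    note measurable_heard[OF ell, measurable]
    have mem: "Measurable.pred ?N (\<lambda>p. f (snd p) \<in> fst p)"
      if [measurable]: "f \<in> measurable (point_space \<Otimes>\<^sub>M point_space) point_space" for f
    proof -
      have "Measurable.pred ?N (\<lambda>p. \<exists>s\<in>fst p. s = f (snd p))"
        by (rule pred_ex_point) measurable
      then show ?thesis by simp
    qed
    note mem[OF measurable_fst, measurable] mem[OF measurable_snd, measurable]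
    have "Measurable.pred ?N (\<lambda>p. fst (snd p) \<in> fst p \<and> snd (snd p) \<in> fst p \<and> fst (snd p) \<noteq> snd (snd p) \<and>
        heard \<tau> N\<^sub>o ell \<gamma> (fst p) (fst (snd p)) (snd (snd p)) \<and>
        heard \<tau> N\<^sub>o ell \<gamma> (fst p) (snd (snd p)) (fst (snd p)))"
      by measurable
    then show ?thesis by (simp add: sinr_graph_def case_prod_beta')
  qed
qed (auto simp: sinr_graph_def sym_def)

section \<open>Random measures and Poisson weights\<close>

lemma space_random_measure_algebra:
  "space (random_measure_algebra :: 'a::euclidean_space measure measure) = locally_finite_measures"
  unfolding random_measure_algebra_def space_Sup_eq_UN by (auto intro: exI[of _ "{}"])

lemma measurable_random_measure_eval:
  assumes "B \<in> sets borel"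
  shows "(\<lambda>L. emeasure L B) \<in> borel_measurable random_measure_algebra"
  unfolding random_measure_algebra_def
  by (rule measurable_SUP1[OF assms]) (auto intro: measurable_vimage_algebra1)

lemma measurable_into_random_measure_algebra:
  assumes "\<And>x. x \<in> space N \<Longrightarrow> f x \<in> locally_finite_measures"
    and "\<And>B. B \<in> sets borel \<Longrightarrow> (\<lambda>x. emeasure (f x) B) \<in> borel_measurable N"
  shows "f \<in> measurable N random_measure_algebra"
  unfolding random_measure_algebra_def
proof (rule measurable_SUP2)
  show "f \<in> measurable N (vimage_algebra locally_finite_measures (\<lambda>L. emeasure L B) borel)"
    if "B \<in> sets borel" for B
    by (rule measurable_vimage_algebra2) (use assms that in auto)
qed auto

lemma locally_finite_measures_sets: "L \<in> locally_finite_measures \<Longrightarrow> sets L = sets borel"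
  by (simp add: locally_finite_measures_def)

lemma borel_measurable_locally_finite:
  assumes "f \<in> borel_measurable borel" "L \<in> space random_measure_algebra"
  shows "f \<in> borel_measurable L"
proof -
  have sets_L: "sets L = sets borel"
    using assms(2) locally_finite_measures_sets by (simp add: space_random_measure_algebra)
  show ?thesis by (subst measurable_cong_sets[OF sets_L refl]) (rule assms(1))
qed

lemma measurable_random_measure_nn_integral:
  assumes "f \<in> borel_measurable (borel :: 'a::euclidean_space measure)"
  shows "(\<lambda>L. \<integral>\<^sup>+x. f x \<partial>L) \<in> borel_measurable random_measure_algebra"
  using assms
proof (induction rule: borel_measurable_induct)
  case (cong f g)
  have "(\<integral>\<^sup>+x. g x \<partial>L) = (\<integral>\<^sup>+x. f x \<partial>L)" for L
    using cong.hyps(3) by (intro nn_integral_cong) simp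
  then show ?case using cong.IH by simp
next
  case (set A)
  have "(\<integral>\<^sup>+x. indicator A x \<partial>L) = emeasure L A" if "L \<in> space random_measure_algebra" for L
  proof -
    have "sets L = sets borel"
      using that locally_finite_measures_sets by (simp add: space_random_measure_algebra)
    then show ?thesis using set by simp
  qed
  then show ?case
    using measurable_random_measure_eval[OF set] by (rule iffD2[OF measurable_cong])
next
  case (mult u c)
  have "(\<integral>\<^sup>+x. c * u x \<partial>L) = c * (\<integral>\<^sup>+x. u x \<partial>L)" if "L \<in> space random_measure_algebra" for L
    by (rule nn_integral_cmult; rule borel_measurable_locally_finite[OF _ that]; fact)
  moreover have "(\<lambda>L. c * (\<integral>\<^sup>+x. u x \<partial>L)) \<in> borel_measurable random_measure_algebra"
    using mult.IH by measurable
  ultimately show ?case by (rule iffD2[OF measurable_cong])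
next
  case (add u v)
  have "(\<integral>\<^sup>+x. v x + u x \<partial>L) = (\<integral>\<^sup>+x. v x \<partial>L) + (\<integral>\<^sup>+x. u x \<partial>L)"
    if "L \<in> space random_measure_algebra" for L
    by (rule nn_integral_add; rule borel_measurable_locally_finite[OF _ that]; fact)
  moreover have "(\<lambda>L. (\<integral>\<^sup>+x. v x \<partial>L) + (\<integral>\<^sup>+x. u x \<partial>L)) \<in> borel_measurable random_measure_algebra"
    using add.IH by measurable
  ultimately show ?case by (rule iffD2[OF measurable_cong])
next
  case (seq U)
  have "(\<integral>\<^sup>+x. (SUP i. U i) x \<partial>L) = (SUP i. \<integral>\<^sup>+x. U i x \<partial>L)"
    if "L \<in> space random_measure_algebra" for L
    unfolding SUP_apply
  proof (rule nn_integral_monotone_convergence_SUP)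
    show "incseq U" by fact
    show "U i \<in> borel_measurable L" for i
      by (rule borel_measurable_locally_finite[OF _ that]) fact
  qed
  moreover have "(\<lambda>L. SUP i. \<integral>\<^sup>+x. U i x \<partial>L) \<in> borel_measurable random_measure_algebra"
    using seq.IH by measurable
  ultimately show ?case by (rule iffD2[OF measurable_cong])
qed

lemma translate_locally_finite:
  fixes L :: "'a::euclidean_space measure"
  assumes L: "L \<in> locally_finite_measures"
  shows "distr L borel (\<lambda>y. v + y) \<in> locally_finite_measures"
  unfolding locally_finite_measures_def
proof (intro CollectI conjI ballI impI)
  note sets_L = locally_finite_measures_sets[OF L]
  fix B :: "'a set" assume B: "B \<in> sets borel" "bounded B"
  have m: "(\<lambda>y. v + y) \<in> measurable L borel"
    by (simp add: measurable_cong_sets[OF sets_L refl])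
  have "emeasure (distr L borel (\<lambda>y. v + y)) B = emeasure L ((\<lambda>y. v + y) -` B)"
    using B sets_eq_imp_space_eq[OF sets_L] by (simp add: emeasure_distr[OF m])
  moreover have "(\<lambda>y. v + y) -` B \<in> sets borel"
    using measurable_sets[OF m B(1)] sets_L sets_eq_imp_space_eq[OF sets_L] by simp
  moreover have eq: "(\<lambda>y. v + y) -` B = (\<lambda>y. - v + y) ` B"
    by (auto intro!: image_eqI[of _ _ "v + _"])
  have "bounded ((\<lambda>y. v + y) -` B)"
    unfolding eq by (rule bounded_translation[OF B(2)])
  ultimately show "emeasure (distr L borel (\<lambda>y. v + y)) B < \<infinity>"
    using L by (simp add: locally_finite_measures_def)
qed simp

text \<open>The mean number of points in \<open>B\<close> given that the environment is \<open>L\<close>.\<close>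

definition mean_count :: "real measure \<Rightarrow> real \<Rightarrow> ('a::euclidean_space \<times> real) set \<Rightarrow> 'a measure \<Rightarrow> real" where
  "mean_count \<mu> a B L = measure (scale_measure (ennreal a) L \<Otimes>\<^sub>M \<mu>) B"

context
  fixes \<mu> :: "real measure"
  assumes \<mu>: "prob_space \<mu>" and sets_\<mu>: "sets \<mu> = sets mark_space"
begin

lemma measurable_mark_section:
  assumes B: "B \<in> sets (point_space :: ('a::euclidean_space \<times> real) measure)"
  shows "(\<lambda>x. emeasure \<mu> (Pair x -` B)) \<in> borel_measurable (borel :: 'a measure)"
proof -
  interpret prob_space \<mu> by (rule \<mu>)
  have "B \<in> sets (borel \<Otimes>\<^sub>M \<mu>)"
    using B by (subst sets_pair_measure_cong[OF refl sets_\<mu>])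
  then show ?thesis by (rule measurable_emeasure_Pair)
qed

lemma emeasure_scaled_product:
  assumes L: "L \<in> locally_finite_measures"
    and B: "B \<in> sets (point_space :: ('a::euclidean_space \<times> real) measure)"
  shows "emeasure (scale_measure (ennreal a) L \<Otimes>\<^sub>M \<mu>) B = ennreal a * (\<integral>\<^sup>+x. emeasure \<mu> (Pair x -` B) \<partial>L)"
proof -
  interpret prob_space \<mu> by (rule \<mu>)
  note sets_L = locally_finite_measures_sets[OF L]
  have "B \<in> sets (scale_measure (ennreal a) L \<Otimes>\<^sub>M \<mu>)"
    using B sets_pair_measure_cong[of "scale_measure (ennreal a) L" borel \<mu> mark_space] sets_L sets_\<mu>
    by simp
  then have "emeasure (scale_measure (ennreal a) L \<Otimes>\<^sub>M \<mu>) B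
      = (\<integral>\<^sup>+x. emeasure \<mu> (Pair x -` B) \<partial>scale_measure (ennreal a) L)"
    by (rule emeasure_pair_measure_alt)
  also have "\<dots> = ennreal a * (\<integral>\<^sup>+x. emeasure \<mu> (Pair x -` B) \<partial>L)"
    using measurable_mark_section[OF B]
    by (intro nn_integral_scale_measure) (simp add: measurable_cong_sets[OF sets_L refl])
  finally show ?thesis .
qed

lemma mean_count_eq:
  assumes "L \<in> locally_finite_measures" "B \<in> sets (point_space :: ('a::euclidean_space \<times> real) measure)"
  shows "mean_count \<mu> a B L = enn2real (ennreal a * (\<integral>\<^sup>+x. emeasure \<mu> (Pair x -` B) \<partial>L))"
  by (simp add: mean_count_def measure_def emeasure_scaled_product[OF assms])

lemma measurable_mean_count:
  assumes B: "B \<in> sets (point_space :: ('a::euclidean_space \<times> real) measure)"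
  shows "mean_count \<mu> a B \<in> borel_measurable random_measure_algebra"
proof -
  note measurable_random_measure_nn_integral[OF measurable_mark_section[OF B], measurable]
  have "(\<lambda>L. enn2real (ennreal a * (\<integral>\<^sup>+x. emeasure \<mu> (Pair x -` B) \<partial>L)))
      \<in> borel_measurable random_measure_algebra"
    by measurable
  then show ?thesis
    by (rule iffD2[OF measurable_cong, rotated])
      (simp add: mean_count_eq[OF _ B] space_random_measure_algebra)
qed

lemma mean_count_translate:
  assumes L: "L \<in> locally_finite_measures"
    and B: "B \<in> sets (point_space :: ('a::euclidean_space \<times> real) measure)"
  shows "mean_count \<mu> a B (distr L borel (\<lambda>y. v + y))
    = mean_count \<mu> a {s \<in> space point_space. translate v s \<in> B} L"
proof -
  note sets_L = locally_finite_measures_sets[OF L]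
  have B': "{s \<in> space point_space. translate v s \<in> B} \<in> sets point_space"
    using B by measurable
  have "Pair x -` {s \<in> space point_space. translate v s \<in> B} = Pair (v + x) -` B" for x
    using sets.sets_into_space[OF B] by (auto simp: space_point_space translate_def)
  moreover have "(\<integral>\<^sup>+x. emeasure \<mu> (Pair x -` B) \<partial>distr L borel (\<lambda>y. v + y))
      = (\<integral>\<^sup>+x. emeasure \<mu> (Pair (v + x) -` B) \<partial>L)"
    using measurable_mark_section[OF B]
    by (intro nn_integral_distr) (simp_all add: measurable_cong_sets[OF sets_L refl])
  ultimately show ?thesis
    by (simp add: mean_count_eq[OF _ B] mean_count_eq[OF L B'] translate_locally_finite L)
qed

lemma emeasure_scaled_product_finite:
  assumes L: "L \<in> locally_finite_measures" and C: "C \<in> sets borel" "bounded C"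
  shows "ennreal (mean_count \<mu> a (C \<times> {0..}) L) = ennreal a * emeasure L C"
proof -
  interpret prob_space \<mu> by (rule \<mu>)
  have sp: "space \<mu> = {0..}" using sets_eq_imp_space_eq[OF sets_\<mu>] by simp
  have CB: "C \<times> {0..} \<in> sets (point_space :: ('a::euclidean_space \<times> real) measure)"
    using C by (intro pair_measureI) (auto simp: sets_restrict_space_iff)
  have "emeasure \<mu> (Pair x -` (C \<times> {0..})) = indicator C x" for x :: 'a
    using emeasure_space_1 sp by (cases "x \<in> C") auto
  then have "(\<integral>\<^sup>+x. emeasure \<mu> (Pair x -` (C \<times> {0..})) \<partial>L) = emeasure L C"
    using locally_finite_measures_sets[OF L] C by simp
  moreover have "emeasure L C < \<infinity>" using L C by (simp add: locally_finite_measures_def)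
  then have "ennreal a * emeasure L C < \<infinity>" by (simp add: ennreal_mult_less_top)
  ultimately show ?thesis
    by (simp add: mean_count_eq[OF L CB])
qed

end

lemma measurable_translate_measure:
  "(\<lambda>L. distr L borel (\<lambda>y. v + y)) \<in>
    measurable random_measure_algebra (random_measure_algebra :: 'a::euclidean_space measure measure)"
proof (rule measurable_into_random_measure_algebra)
  fix B :: "'a set" assume B: "B \<in> sets borel"
  have B': "(\<lambda>y. v + y) -` B \<in> sets borel"
    using measurable_sets[of "\<lambda>y. v + y" borel borel B] B by simp
  have "emeasure (distr L borel (\<lambda>y. v + y)) B = emeasure L ((\<lambda>y. v + y) -` B)"
    if "L \<in> space random_measure_algebra" for L
  proof -
    have sets_L: "sets L = sets borel"
      using that locally_finite_measures_sets by (simp add: space_random_measure_algebra)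
    then show ?thesis
      using B sets_eq_imp_space_eq[OF sets_L]
      by (subst emeasure_distr) (simp_all add: measurable_cong_sets[OF sets_L refl])
  qed
  then show "(\<lambda>L. emeasure (distr L borel (\<lambda>y. v + y)) B) \<in> borel_measurable random_measure_algebra"
    using measurable_random_measure_eval[OF B'] by (rule iffD2[OF measurable_cong])
qed (simp add: space_random_measure_algebra translate_locally_finite)

lemma poisson_weight_sums_mean:
  assumes "0 \<le> r"
  shows "(\<Sum>k. of_nat k * ennreal (poisson_weight r k)) = ennreal r"
proof -
  have "(\<lambda>k. r * (exp (- r) * (r ^ k /\<^sub>R fact k))) sums (r * (exp (- r) * exp r))"
    by (intro sums_mult exp_converges)
  moreover have "r * (exp (- r) * (r ^ k /\<^sub>R fact k)) = of_nat (Suc k) * poisson_weight r (Suc k)" for k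
    by (simp add: poisson_weight_def field_simps del: of_nat_Suc)
  moreover have "exp (- r) * exp r = 1" by (simp flip: exp_add)
  ultimately have "(\<lambda>k. of_nat (Suc k) * poisson_weight r (Suc k)) sums r" by simp
  then have "(\<lambda>k. of_nat k * poisson_weight r k) sums r"
    by (subst (asm) sums_Suc_iff) simp
  then have "(\<Sum>k. ennreal (of_nat k * poisson_weight r k)) = ennreal r"
    using assms by (intro suminf_ennreal_eq) (simp_all add: poisson_weight_def)
  moreover have "ennreal (of_nat k * poisson_weight r k) = of_nat k * ennreal (poisson_weight r k)" for k
    by (simp add: ennreal_mult' ennreal_of_nat_eq_real_of_nat)
  ultimately show ?thesis by simp
qed

section \<open>The marked Cox process\<close>

text \<open>A marked Cox process whose points almost surely have distinct locations.\<close>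

locale cox_process = prob_space M
  for M :: "'w measure" +
  fixes \<Lambda> :: "'w \<Rightarrow> 'a::euclidean_space measure" and \<mu> :: "real measure" and a :: real
    and I :: "'w \<Rightarrow> nat set" and X :: "nat \<Rightarrow> 'w \<Rightarrow> 'a" and P :: "nat \<Rightarrow> 'w \<Rightarrow> real"
  assumes stationary: "stationary_random_measure M \<Lambda>"
    and unit_intensity: "(\<integral>\<^sup>+\<omega>. emeasure (\<Lambda> \<omega>) unit_cube \<partial>M) = 1"
    and prob_marks: "prob_space \<mu>" and sets_marks: "sets \<mu> = sets mark_space"
    and cox: "marked_cox_process M \<Lambda> \<mu> a I X P"
    and simple_AE: "AE \<omega> in M. inj_on (\<lambda>i. X i \<omega>) (I \<omega>)"
begin

text \<open>The process as a random configuration, set to be empty on the null set where two points share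
  a location.\<close>

definition process :: "'w \<Rightarrow> ('a \<times> real) set" where
  "process \<omega> = (if inj_on (\<lambda>i. X i \<omega>) (I \<omega>) then (\<lambda>i. (X i \<omega>, P i \<omega>)) ` I \<omega> else {})"

lemma measurable_\<Lambda> [measurable]: "\<Lambda> \<in> measurable M random_measure_algebra"
  using stationary by (simp add: stationary_random_measure_def)

lemma \<Lambda>_locally_finite: "\<omega> \<in> space M \<Longrightarrow> \<Lambda> \<omega> \<in> locally_finite_measures"
  using measurable_space[OF measurable_\<Lambda>] by (simp add: space_random_measure_algebra)

lemma measurable_points [measurable]:
  "Measurable.pred M (\<lambda>\<omega>. i \<in> I \<omega>)" "X i \<in> borel_measurable M" "P i \<in> measurable M mark_space"
  using cox by (simp_all add: marked_cox_process_def marked_point_process_def pred_def)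

lemma locally_finite_points: "\<omega> \<in> space M \<Longrightarrow> bounded B \<Longrightarrow> finite {i \<in> I \<omega>. X i \<omega> \<in> B}"
  using cox by (simp add: marked_cox_process_def marked_point_process_def)

lemma process_configurations: "\<omega> \<in> space M \<Longrightarrow> process \<omega> \<in> configurations"
proof (cases "inj_on (\<lambda>i. X i \<omega>) (I \<omega>)")
  case True
  assume \<omega>: "\<omega> \<in> space M"
  have "P i \<omega> \<ge> 0" for i
    using measurable_space[OF measurable_points(3) \<omega>, of i] by simp
  moreover have "finite {s \<in> process \<omega>. fst s \<in> B}" if "bounded B" for B
  proof -
    have "{s \<in> process \<omega>. fst s \<in> B} = (\<lambda>i. (X i \<omega>, P i \<omega>)) ` {i \<in> I \<omega>. X i \<omega> \<in> B}"
      using True by (auto simp: process_def)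
    then show ?thesis using locally_finite_points[OF \<omega> that] by simp
  qed
  ultimately show ?thesis
    using True by (auto simp: configurations_def process_def space_point_space inj_on_def)
qed (simp add: process_def configurations_empty)

lemma card_process:
  "card (process \<omega> \<inter> B) = (if inj_on (\<lambda>i. X i \<omega>) (I \<omega>) then point_count I X P B \<omega> else 0)"
proof (cases "inj_on (\<lambda>i. X i \<omega>) (I \<omega>)")
  case True
  have "process \<omega> \<inter> B = (\<lambda>i. (X i \<omega>, P i \<omega>)) ` {i \<in> I \<omega>. (X i \<omega>, P i \<omega>) \<in> B}"
    using True by (auto simp: process_def)
  moreover have "inj_on (\<lambda>i. (X i \<omega>, P i \<omega>)) {i \<in> I \<omega>. (X i \<omega>, P i \<omega>) \<in> B}"
    using True by (auto simp: inj_on_def)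
  ultimately show ?thesis using True by (simp add: point_count_def card_image)
qed (simp add: process_def)

lemma measurable_point_count:
  assumes [measurable]: "B \<in> sets point_space"
  shows "point_count I X P B \<in> measurable M (count_space UNIV)"
proof -
  have "(\<lambda>\<omega>. card {i \<in> I \<omega>. (X i \<omega>, P i \<omega>) \<in> B}) \<in> measurable M (count_space UNIV)"
    by (rule measurable_card) measurable
  then show ?thesis by (simp add: point_count_def[abs_def])
qed

lemma measurable_process [measurable]: "process \<in> measurable M configuration_algebra"
proof (rule measurable_into_configuration_algebra)
  fix B :: "('a \<times> real) set" assume "B \<in> windows"
  then have [measurable]: "point_count I X P B \<in> measurable M (count_space UNIV)"
    by (intro measurable_point_count windows_sets)
  have "Measurable.pred M (\<lambda>\<omega>. \<forall>i j. i \<in> I \<omega> \<longrightarrow> j \<in> I \<omega> \<longrightarrow> X i \<omega> = X j \<omega> \<longrightarrow> i = j)"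
    by measurable
  then have [measurable]: "Measurable.pred M (\<lambda>\<omega>. inj_on (\<lambda>i. X i \<omega>) (I \<omega>))"
    by (simp add: inj_on_def Ball_def)
  show "(\<lambda>\<omega>. card (process \<omega> \<inter> B)) \<in> measurable M (count_space UNIV)"
    unfolding card_process by measurable
qed (rule process_configurations)

text \<open>The \<open>\<sigma>\<close>-algebra generated by the environment \<open>\<Lambda>\<close>.\<close>

definition env :: "'w measure" where
  "env = vimage_algebra (space M) \<Lambda> random_measure_algebra"

sublocale env: finite_measure_subalgebra M env
proof
  show "subalgebra M env"
    unfolding subalgebra_def env_def
  proof
    show "sets (vimage_algebra (space M) \<Lambda> random_measure_algebra) \<subseteq> sets M"
      using measurable_sets[OF measurable_\<Lambda>] measurable_space[OF measurable_\<Lambda>]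
      by (subst sets_vimage_algebra2) auto
  qed simp
qed

definition mean :: "('a \<times> real) set \<Rightarrow> 'w \<Rightarrow> real" where
  "mean B \<omega> = mean_count \<mu> a B (\<Lambda> \<omega>)"

lemma measurable_mean:
  assumes "B \<in> windows"
  shows "mean B \<in> borel_measurable M"
  using measurable_compose[OF measurable_\<Lambda> measurable_mean_count[OF prob_marks sets_marks windows_sets[OF assms]]]
  by (simp add: mean_def[abs_def])

lemma mean_nonneg: "0 \<le> mean B \<omega>"
  by (simp add: mean_def mean_count_def)

definition counts_are :: "nat \<Rightarrow> (nat \<Rightarrow> ('a \<times> real) set) \<Rightarrow> (nat \<Rightarrow> nat) \<Rightarrow> 'w set" where
  "counts_are n B k = {\<omega> \<in> space M. \<forall>m<n. card (process \<omega> \<inter> B m) = k m}"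

lemma sets_counts_are:
  assumes "\<And>m. m < n \<Longrightarrow> B m \<in> windows"
  shows "counts_are n B k \<in> sets M"
proof -
  have "{\<omega> \<in> space M. \<forall>m\<in>{..<n}. card (process \<omega> \<inter> B m) = k m} \<in> sets M"
  proof (rule sets.sets_Collect_finite_All)
    fix m assume "m \<in> {..<n}"
    then have [measurable]: "B m \<in> windows" using assms by simp
    show "{\<omega> \<in> space M. card (process \<omega> \<inter> B m) = k m} \<in> sets M" by measurable
  qed simp
  then show ?thesis by (simp only: counts_are_def Ball_def lessThan_iff)
qed

lemma cond_exp_counts_are:
  assumes B: "\<And>m. m < n \<Longrightarrow> B m \<in> windows" and dis: "disjoint_family_on B {..<n}"
  shows "AE \<omega> in M. real_cond_exp M env (indicator (counts_are n B k)) \<omega>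
    = (\<Prod>m<n. poisson_weight (mean (B m) \<omega>) (k m))"
proof -
  have C: "AE \<omega> in M. real_cond_exp M env
      (indicator {\<omega>\<in>space M. \<forall>m<n. point_count I X P (B m) \<omega> = k m}) \<omega>
      = (\<Prod>m<n. poisson_weight (mean (B m) \<omega>) (k m))"
    using cox B dis unfolding marked_cox_process_def windows_def env_def mean_def mean_count_def by blast
  have "{\<omega>\<in>space M. \<forall>m\<in>{..<n}. point_count I X P (B m) \<omega> = k m} \<in> sets M"
  proof (rule sets.sets_Collect_finite_All)
    fix m assume "m \<in> {..<n}"
    then have [measurable]: "point_count I X P (B m) \<in> measurable M (count_space UNIV)"
      using B by (intro measurable_point_count windows_sets) simp
    show "{\<omega> \<in> space M. point_count I X P (B m) \<omega> = k m} \<in> sets M" by measurable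
  qed simp
  then have pc: "{\<omega>\<in>space M. \<forall>m<n. point_count I X P (B m) \<omega> = k m} \<in> sets M"
    by (simp only: Ball_def lessThan_iff)
  have "AE \<omega> in M. (indicator (counts_are n B k) \<omega> :: real)
      = indicator {\<omega>\<in>space M. \<forall>m<n. point_count I X P (B m) \<omega> = k m} \<omega>"
    using simple_AE by eventually_elim (simp add: counts_are_def card_process indicator_def)
  then have "AE \<omega> in M. real_cond_exp M env (indicator (counts_are n B k)) \<omega>
      = real_cond_exp M env (indicator {\<omega>\<in>space M. \<forall>m<n. point_count I X P (B m) \<omega> = k m}) \<omega>"
    by (rule env.real_cond_exp_cong)
      (rule borel_measurable_indicator[OF sets_counts_are[OF B]] borel_measurable_indicator[OF pc] | assumption)+
  with C show ?thesis by eventually_elim simp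
qed
section \<open>Stationarity, intensity and deletion tolerance\<close>


definition law :: "('a \<times> real) set measure" where
  "law = distr M configuration_algebra process"

lemma sets_law [simp]: "sets law = sets configuration_algebra"
  by (simp add: law_def)

lemma emeasure_law:
  assumes "A \<in> sets configuration_algebra"
  shows "emeasure law A = emeasure M (process -` A \<inter> space M)"
  unfolding law_def by (rule emeasure_distr[OF measurable_process assms])

lemma AE_law:
  assumes "Measurable.pred configuration_algebra Q"
  shows "(AE S in law. Q S) \<longleftrightarrow> (AE \<omega> in M. Q (process \<omega>))"
  unfolding law_def using assms by (intro AE_distr_iff measurable_process) (simp add: pred_def)

lemma sets_count_event:
  assumes "\<And>m. m < n \<Longrightarrow> B m \<in> windows"
  shows "{S \<in> configurations. \<forall>m<(n::nat). card (S \<inter> B m) = k m} \<in> sets configuration_algebra"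
proof -
  have "{S \<in> space configuration_algebra. \<forall>m\<in>{..<n}. card (S \<inter> B m) = k m} \<in> sets configuration_algebra"
  proof (rule sets.sets_Collect_finite_All)
    fix m assume "m \<in> {..<n}"
    then have [measurable]: "B m \<in> windows" using assms by simp
    show "{S \<in> space configuration_algebra. card (S \<inter> B m) = k m} \<in> sets configuration_algebra"
      by measurable
  qed simp
  then show ?thesis by (simp only: Ball_def lessThan_iff space_configuration_algebra)
qed

lemma prob_counts_are:
  assumes B: "\<And>m. m < n \<Longrightarrow> B m \<in> windows" and dis: "disjoint_family_on B {..<n}"
  shows "prob (counts_are n B k) = (\<integral>\<omega>. (\<Prod>m<n. poisson_weight (mean (B m) \<omega>) (k m)) \<partial>M)"
proof -
  have [measurable]: "counts_are n B k \<in> sets M" by (rule sets_counts_are[OF B])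
  have [measurable]: "(\<lambda>\<omega>. \<Prod>m<n. poisson_weight (mean (B m) \<omega>) (k m)) \<in> borel_measurable M"
    unfolding poisson_weight_def using measurable_mean[OF B] by (intro borel_measurable_prod) simp
  have int: "integrable M (indicator (counts_are n B k) :: 'w \<Rightarrow> real)"
    by (rule integrable_real_indicator) (simp_all add: emeasure_eq_measure)
  have "prob (counts_are n B k) = (\<integral>\<omega>. indicator (counts_are n B k) \<omega> \<partial>M)" by simp
  also have "\<dots> = (\<integral>\<omega>. real_cond_exp M env (indicator (counts_are n B k)) \<omega> \<partial>M)"
    by (rule env.real_cond_exp_int(2)[OF int, symmetric])
  also have "\<dots> = (\<integral>\<omega>. (\<Prod>m<n. poisson_weight (mean (B m) \<omega>) (k m)) \<partial>M)"
    by (rule integral_cong_AE) (simp_all add: cond_exp_counts_are[OF B dis])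
  finally show ?thesis .
qed

lemma \<Lambda>_translate:
  assumes [measurable]: "h \<in> borel_measurable random_measure_algebra"
  shows "(\<integral>\<omega>. h (distr (\<Lambda> \<omega>) borel (\<lambda>y. v + y)) \<partial>M) = (\<integral>\<omega>. h (\<Lambda> \<omega>) \<partial>M :: real)"
proof -
  have m: "(\<lambda>\<omega>. distr (\<Lambda> \<omega>) borel (\<lambda>y. v + y)) \<in> measurable M random_measure_algebra"
    by (rule measurable_compose[OF measurable_\<Lambda> measurable_translate_measure])
  have "distr M random_measure_algebra (\<lambda>\<omega>. distr (\<Lambda> \<omega>) borel (\<lambda>y. v + y)) = distr M random_measure_algebra \<Lambda>"
    using stationary by (simp add: stationary_random_measure_def)
  then show ?thesis
    using integral_distr[OF m assms] integral_distr[OF measurable_\<Lambda> assms] by simp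
qed

lemma law_stationary: "distr law configuration_algebra (\<lambda>S. translate v ` S) = law"
proof (rule configuration_measure_eqI)
  have ml: "(\<lambda>S. translate v ` S) \<in> measurable law configuration_algebra"
    by (subst measurable_cong_sets[OF sets_law refl]) (rule measurable_translate_image)
  show "emeasure (distr law configuration_algebra (\<lambda>S. translate v ` S)) configurations \<noteq> \<infinity>"
  proof -
    have "prob_space law" unfolding law_def by (rule prob_space_distr[OF measurable_process])
    then have "prob_space (distr law configuration_algebra (\<lambda>S. translate v ` S))"
      by (rule prob_space.prob_space_distr[OF _ ml])
    from prob_space.emeasure_space_1[OF this] show ?thesis by simp
  qed
  fix n :: nat and B :: "nat \<Rightarrow> ('a \<times> real) set" and k :: "nat \<Rightarrow> nat"
  assume B: "\<And>m. m < n \<Longrightarrow> B m \<in> windows" and dis: "disjoint_family_on B {..<n}"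
  let ?Z = "{S \<in> configurations. \<forall>m<n. card (S \<inter> B m) = k m}"
  have Z: "?Z \<in> sets configuration_algebra" by (rule sets_count_event[OF B])
  \<comment> \<open>Counts of the translated process in \<open>B m\<close> are counts of the process in \<open>B' m\<close>.\<close>
  define B' where "B' m = {s \<in> space point_space. translate v s \<in> B m}" for m
  have B': "B' m \<in> windows" if "m < n" for m
    unfolding B'_def using translate_vimage_windows B that by blast
  have dis': "disjoint_family_on B' {..<n}"
    using dis unfolding disjoint_family_on_def B'_def by blast
  have "emeasure (distr law configuration_algebra (\<lambda>S. translate v ` S)) ?Z
      = emeasure law ((\<lambda>S. translate v ` S) -` ?Z \<inter> space law)"
    by (rule emeasure_distr[OF ml Z])
  also have "\<dots> = emeasure M (process -` ((\<lambda>S. translate v ` S) -` ?Z \<inter> space law) \<inter> space M)"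
    using measurable_sets[OF ml Z] by (intro emeasure_law) simp
  also have "process -` ((\<lambda>S. translate v ` S) -` ?Z \<inter> space law) \<inter> space M = counts_are n B' k"
    using process_configurations translate_configurations
    by (auto simp: counts_are_def law_def B'_def card_translate_Int)
  also have "emeasure M (counts_are n B' k)
      = ennreal (\<integral>\<omega>. (\<Prod>m<n. poisson_weight (mean (B' m) \<omega>) (k m)) \<partial>M)"
    using prob_counts_are[OF B' dis', of k] by (simp add: emeasure_eq_measure)
  also have "(\<integral>\<omega>. (\<Prod>m<n. poisson_weight (mean (B' m) \<omega>) (k m)) \<partial>M)
      = (\<integral>\<omega>. (\<Prod>m<n. poisson_weight (mean_count \<mu> a (B m) (distr (\<Lambda> \<omega>) borel (\<lambda>y. v + y))) (k m)) \<partial>M)"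
    unfolding mean_def B'_def
    by (intro Bochner_Integration.integral_cong prod.cong refl)
      (simp add: mean_count_translate[OF prob_marks sets_marks] \<Lambda>_locally_finite windows_sets B)
  also have "\<dots> = (\<integral>\<omega>. (\<Prod>m<n. poisson_weight (mean_count \<mu> a (B m) (\<Lambda> \<omega>)) (k m)) \<partial>M)"
  proof (rule \<Lambda>_translate)
    show "(\<lambda>L. \<Prod>m<n. poisson_weight (mean_count \<mu> a (B m) L) (k m)) \<in> borel_measurable random_measure_algebra"
      unfolding poisson_weight_def
      using measurable_mean_count[OF prob_marks sets_marks windows_sets[OF B]]
      by (intro borel_measurable_prod) simp
  qed
  also have "ennreal \<dots> = emeasure M (counts_are n B k)"
    using prob_counts_are[OF B dis, of k] by (simp add: emeasure_eq_measure mean_def)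
  also have "counts_are n B k = process -` ?Z \<inter> space M"
    using process_configurations by (auto simp: counts_are_def)
  also have "emeasure M \<dots> = emeasure law ?Z" by (rule emeasure_law[OF Z, symmetric])
  finally show "emeasure (distr law configuration_algebra (\<lambda>S. translate v ` S)) ?Z = emeasure law ?Z" .
qed simp_all

lemma law_intensity: "(\<integral>\<^sup>+S. of_nat (card (S \<inter> cube 0 \<times> {0..})) \<partial>law) < \<infinity>"
proof -
  let ?B = "cube 0 \<times> {0..} :: ('a \<times> real) set"
  have [measurable]: "?B \<in> windows" by (rule cube_window)
  have [measurable]: "mean ?B \<in> borel_measurable M" by (rule measurable_mean) measurable
  have [measurable]: "(\<lambda>\<omega>. card (process \<omega> \<inter> ?B)) \<in> measurable M (count_space UNIV)"
    by (rule measurable_compose[OF measurable_process measurable_count]) (rule cube_window)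
  have "(\<integral>\<^sup>+S. of_nat (card (S \<inter> ?B)) \<partial>law) = (\<integral>\<^sup>+\<omega>. of_nat (card (process \<omega> \<inter> ?B)) \<partial>M)"
    unfolding law_def by (rule nn_integral_distr) measurable
  also have "\<dots> = (\<integral>\<^sup>+\<omega>. (\<Sum>k. of_nat k * indicator (counts_are 1 (\<lambda>_. ?B) (\<lambda>_. k)) \<omega>) \<partial>M)"
  proof (rule nn_integral_cong)
    fix \<omega> assume \<omega>: "\<omega> \<in> space M"
    have "(\<Sum>k. of_nat k * indicator (counts_are 1 (\<lambda>_. ?B) (\<lambda>_. k)) \<omega> :: ennreal)
        = (\<Sum>k\<in>{card (process \<omega> \<inter> ?B)}. of_nat k * indicator (counts_are 1 (\<lambda>_. ?B) (\<lambda>_. k)) \<omega>)"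
      by (rule suminf_finite) (auto simp: counts_are_def indicator_def)
    also have "\<dots> = of_nat (card (process \<omega> \<inter> ?B))"
      using \<omega> by (simp add: counts_are_def)
    finally show "(of_nat (card (process \<omega> \<inter> ?B)) :: ennreal)
        = (\<Sum>k. of_nat k * indicator (counts_are 1 (\<lambda>_. ?B) (\<lambda>_. k)) \<omega>)" ..
  qed
  also have "\<dots> = (\<Sum>k. \<integral>\<^sup>+\<omega>. of_nat k * indicator (counts_are 1 (\<lambda>_. ?B) (\<lambda>_. k)) \<omega> \<partial>M)"
  proof (rule nn_integral_suminf)
    fix k
    have [measurable]: "counts_are 1 (\<lambda>_. ?B) (\<lambda>_. k) \<in> sets M"
      by (rule sets_counts_are) (rule cube_window)
    show "(\<lambda>\<omega>. of_nat k * indicator (counts_are 1 (\<lambda>_. ?B) (\<lambda>_. k)) \<omega> :: ennreal) \<in> borel_measurable M"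
      by measurable
  qed
  also have "\<dots> = (\<Sum>k. \<integral>\<^sup>+\<omega>. of_nat k * ennreal (poisson_weight (mean ?B \<omega>) k) \<partial>M)"
  proof (rule suminf_cong)
    fix k
    have C: "counts_are 1 (\<lambda>_. ?B) (\<lambda>_. k) \<in> sets M"
      by (rule sets_counts_are) (rule cube_window)
    have m: "(\<lambda>\<omega>. poisson_weight (mean ?B \<omega>) k) \<in> borel_measurable M"
      unfolding poisson_weight_def by measurable
    have bound: "poisson_weight (mean ?B \<omega>) k \<le> 1" for \<omega>
    proof -
      have "(mean ?B \<omega>) ^ k /\<^sub>R fact k \<le> exp (mean ?B \<omega>)"
        using sum_le_suminf[OF summable_exp_generic[of "mean ?B \<omega>"], of "{k}"] mean_nonneg[of ?B \<omega>]
        by (simp add: exp_def)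
      then show ?thesis
        by (simp add: poisson_weight_def exp_minus field_simps)
    qed
    have int: "integrable M (\<lambda>\<omega>. poisson_weight (mean ?B \<omega>) k)"
      by (rule integrable_const_bound[where B = 1]) (use m bound mean_nonneg in \<open>auto simp: poisson_weight_def\<close>)
    have "(\<integral>\<^sup>+\<omega>. of_nat k * indicator (counts_are 1 (\<lambda>_. ?B) (\<lambda>_. k)) \<omega> \<partial>M)
        = of_nat k * emeasure M (counts_are 1 (\<lambda>_. ?B) (\<lambda>_. k))"
      using C by (simp add: nn_integral_cmult)
    also have "emeasure M (counts_are 1 (\<lambda>_. ?B) (\<lambda>_. k)) = ennreal (\<integral>\<omega>. poisson_weight (mean ?B \<omega>) k \<partial>M)"
      using prob_counts_are[of 1 "\<lambda>_. ?B" "\<lambda>_. k", OF cube_window]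
      by (simp add: emeasure_eq_measure disjoint_family_on_def)
    also have "\<dots> = (\<integral>\<^sup>+\<omega>. ennreal (poisson_weight (mean ?B \<omega>) k) \<partial>M)"
      using mean_nonneg by (intro nn_integral_eq_integral[symmetric] int) (simp add: poisson_weight_def)
    also have "of_nat k * \<dots> = (\<integral>\<^sup>+\<omega>. of_nat k * ennreal (poisson_weight (mean ?B \<omega>) k) \<partial>M)"
      using m by (intro nn_integral_cmult[symmetric]) measurable
    finally show "(\<integral>\<^sup>+\<omega>. of_nat k * indicator (counts_are 1 (\<lambda>_. ?B) (\<lambda>_. k)) \<omega> \<partial>M)
        = (\<integral>\<^sup>+\<omega>. of_nat k * ennreal (poisson_weight (mean ?B \<omega>) k) \<partial>M)" .
  qed
  also have "\<dots> = (\<integral>\<^sup>+\<omega>. (\<Sum>k. of_nat k * ennreal (poisson_weight (mean ?B \<omega>) k)) \<partial>M)"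
    by (rule nn_integral_suminf[symmetric]) (simp add: poisson_weight_def)
  also have "\<dots> = (\<integral>\<^sup>+\<omega>. ennreal (mean ?B \<omega>) \<partial>M)"
    by (simp add: poisson_weight_sums_mean mean_nonneg)
  also have "\<dots> = (\<integral>\<^sup>+\<omega>. ennreal a * emeasure (\<Lambda> \<omega>) (cube 0) \<partial>M)"
    unfolding mean_def
    by (intro nn_integral_cong emeasure_scaled_product_finite[OF prob_marks sets_marks])
      (simp_all add: \<Lambda>_locally_finite bounded_cube)
  also have "\<dots> \<le> (\<integral>\<^sup>+\<omega>. ennreal a * emeasure (\<Lambda> \<omega>) unit_cube \<partial>M)"
    by (intro nn_integral_mono mult_left_mono emeasure_mono cube_0_subset)
      (simp_all add: locally_finite_measures_sets[OF \<Lambda>_locally_finite] unit_cube_def)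
  also have "\<dots> = ennreal a * (\<integral>\<^sup>+\<omega>. emeasure (\<Lambda> \<omega>) unit_cube \<partial>M)"
    by (intro nn_integral_cmult measurable_compose[OF measurable_\<Lambda> measurable_random_measure_eval])
      (simp add: unit_cube_def)
  also have "\<dots> < \<infinity>" by (simp add: unit_intensity)
  finally show ?thesis .
qed

text \<open>Given the environment, the configuration outside \<open>U\<close> is independent of the event \<open>void\<close> that \<open>U\<close>
  is empty, and \<open>void\<close> has the strictly positive conditional probability \<open>w\<close>. Hence an event for the
  configuration outside \<open>U\<close> that has positive probability also has positive probability jointly with
  \<open>void\<close>, where the configuration is not changed by deleting \<open>U\<close>.\<close>

lemma deletion_tolerance:
  assumes U: "U \<in> windows" and Q: "Measurable.pred configuration_algebra Q"
    and AE_Q: "AE S in law. Q S"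
  shows "AE S in law. Q (S - U)"
proof -
  define void where "void = {\<omega> \<in> space M. card (process \<omega> \<inter> U) = 0}"
  have void_eq: "counts_are 1 (\<lambda>_. U) (\<lambda>_. 0) = void" by (simp add: counts_are_def void_def)
  have [measurable]: "void \<in> sets M"
    unfolding void_eq[symmetric] by (rule sets_counts_are) (rule U)
  define w where "w = real_cond_exp M env (indicator void)"
  have w_env [measurable]: "w \<in> borel_measurable env" unfolding w_def by simp
  have w_M [measurable]: "w \<in> borel_measurable M" unfolding w_def by simp
  have w_eq: "AE \<omega> in M. w \<omega> = poisson_weight (mean U \<omega>) 0"
    using cond_exp_counts_are[of 1 "\<lambda>_. U" "\<lambda>_. 0", OF U]
    by (simp add: void_eq[simplified] w_def disjoint_family_on_def)
  have w_pos: "AE \<omega> in M. 0 < w \<omega>" and w_le: "AE \<omega> in M. w \<omega> \<le> 1"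
    using w_eq by (eventually_elim, simp add: poisson_weight_def mean_nonneg)+
  define rest where "rest \<omega> = process \<omega> - U" for \<omega>
  have card_rest: "card (rest \<omega> \<inter> B) = card (process \<omega> \<inter> (B - U))" for \<omega> B
    unfolding rest_def by (rule arg_cong[where f = card]) auto
  have rest_conf: "rest \<omega> \<in> configurations" if "\<omega> \<in> space M" for \<omega>
    unfolding rest_def using process_configurations[OF that] by (rule configurations_subset) auto
  have rest_measurable [measurable]: "rest \<in> measurable M configuration_algebra"
  proof (rule measurable_into_configuration_algebra)
    fix B :: "('a \<times> real) set" assume "B \<in> windows"
    then have "B - U \<in> windows" using U by (intro windows_Diff windows_sets)
    then show "(\<lambda>\<omega>. card (rest \<omega> \<inter> B)) \<in> measurable M (count_space UNIV)"
      unfolding card_rest by (intro measurable_compose[OF measurable_process measurable_count])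
  qed (rule rest_conf)
  have rest_void: "rest \<omega> = process \<omega>" if "\<omega> \<in> void" for \<omega>
    using that configurations_finite_window[OF process_configurations U] by (auto simp: void_def rest_def)
  \<comment> \<open>The events for the configuration outside \<open>U\<close>, once restricted to \<open>void\<close> and once weighted with \<open>w\<close>.\<close>
  define N1 where "N1 = distr (density M (indicator void)) configuration_algebra rest"
  define N2 where "N2 = distr (density M (\<lambda>\<omega>. ennreal (w \<omega>))) configuration_algebra rest"
  have N1: "emeasure N1 A = emeasure M (void \<inter> (rest -` A \<inter> space M))"
    if [measurable]: "A \<in> sets configuration_algebra" for A
  proof -
    have "emeasure N1 A = emeasure (density M (indicator void)) (rest -` A \<inter> space M)"
      unfolding N1_def by (subst emeasure_distr) simp_all
    also have "\<dots> = (\<integral>\<^sup>+\<omega>. indicator void \<omega> * indicator (rest -` A \<inter> space M) \<omega> \<partial>M)"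
      by (rule emeasure_density) measurable
    also have "\<dots> = (\<integral>\<^sup>+\<omega>. indicator (void \<inter> (rest -` A \<inter> space M)) \<omega> \<partial>M)"
      by (simp add: indicator_inter_arith)
    finally show ?thesis by simp
  qed
  have N2: "emeasure N2 A = (\<integral>\<^sup>+\<omega>. ennreal (w \<omega>) * indicator (rest -` A \<inter> space M) \<omega> \<partial>M)"
    if [measurable]: "A \<in> sets configuration_algebra" for A
  proof -
    have "emeasure N2 A = emeasure (density M (\<lambda>\<omega>. ennreal (w \<omega>))) (rest -` A \<inter> space M)"
      unfolding N2_def by (subst emeasure_distr) simp_all
    also have "\<dots> = (\<integral>\<^sup>+\<omega>. ennreal (w \<omega>) * indicator (rest -` A \<inter> space M) \<omega> \<partial>M)"
      by (rule emeasure_density) measurable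
    finally show ?thesis .
  qed
  have "N1 = N2"
  proof (rule configuration_measure_eqI)
    have top: "configurations \<in> sets configuration_algebra"
      using sets.top[of configuration_algebra] by simp
    show "emeasure N1 configurations \<noteq> \<infinity>"
      by (subst N1[OF top]) (simp add: emeasure_eq_measure)
    fix n :: nat and B :: "nat \<Rightarrow> ('a \<times> real) set" and k :: "nat \<Rightarrow> nat"
    assume B: "\<And>m. m < n \<Longrightarrow> B m \<in> windows" and dis: "disjoint_family_on B {..<n}"
    let ?Z = "{S \<in> configurations. \<forall>m<n. card (S \<inter> B m) = k m}"
    have Z: "?Z \<in> sets configuration_algebra" by (rule sets_count_event[OF B])
    \<comment> \<open>The windows \<open>B m - U\<close> together with \<open>U\<close> as an \<open>n\<close>-th window form one disjoint family.\<close>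
    define B' where "B' m = (if m < n then B m - U else U)" for m
    define k' where "k' m = (if m < n then k m else 0)" for m
    have B': "B' m \<in> windows" for m
      using B U by (auto simp: B'_def intro!: windows_Diff windows_sets)
    have dis': "disjoint_family_on B' {..<Suc n}" "disjoint_family_on B' {..<n}"
      using dis by (auto simp: disjoint_family_on_def B'_def less_Suc_eq)
    define D where "D = counts_are n B' k'"
    have D [measurable]: "D \<in> sets M" unfolding D_def by (rule sets_counts_are[OF B'])
    have preimage: "rest -` ?Z \<inter> space M = D"
      using rest_conf by (auto simp: D_def counts_are_def card_rest B'_def k'_def)
    have VD: "counts_are (Suc n) B' k' = void \<inter> D"
      by (auto simp: D_def counts_are_def void_def less_Suc_eq B'_def k'_def)
    have [measurable]: "void \<inter> D \<in> sets M" by measurable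
    have cond: "AE \<omega> in M. real_cond_exp M env (indicator (void \<inter> D)) \<omega>
        = w \<omega> * real_cond_exp M env (indicator D) \<omega>"
      using cond_exp_counts_are[OF B' dis'(1), of k'] cond_exp_counts_are[OF B' dis'(2), of k'] w_eq
      unfolding VD D_def[symmetric]
    proof eventually_elim
      case (elim \<omega>)
      have "k' n = 0" "B' n = U" by (simp_all add: k'_def B'_def)
      then show ?case using elim by simp
    qed
    have int_wD: "integrable M (\<lambda>\<omega>. w \<omega> * indicator D \<omega>)"
    proof (rule integrable_const_bound[where B = 1])
      show "AE \<omega> in M. norm (w \<omega> * indicator D \<omega> :: real) \<le> 1"
        using w_pos w_le by eventually_elim (auto simp: indicator_def)
    qed measurable
    have int_VD: "integrable M (indicator (void \<inter> D) :: 'w \<Rightarrow> real)"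
      by (rule integrable_real_indicator) (simp_all add: emeasure_eq_measure)
    have "prob (void \<inter> D) = (\<integral>\<omega>. indicator (void \<inter> D) \<omega> \<partial>M)" by simp
    also have "\<dots> = (\<integral>\<omega>. real_cond_exp M env (indicator (void \<inter> D)) \<omega> \<partial>M)"
      by (rule env.real_cond_exp_int(2)[OF int_VD, symmetric])
    also have "\<dots> = (\<integral>\<omega>. w \<omega> * real_cond_exp M env (indicator D) \<omega> \<partial>M)"
      using cond by (intro integral_cong_AE) simp_all
    also have "\<dots> = (\<integral>\<omega>. w \<omega> * indicator D \<omega> \<partial>M)"
      by (rule env.real_cond_exp_intg(2)[OF int_wD w_env]) measurable
    finally have "emeasure M (void \<inter> D) = ennreal (\<integral>\<omega>. w \<omega> * indicator D \<omega> \<partial>M)"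
      by (simp add: emeasure_eq_measure)
    also have "\<dots> = (\<integral>\<^sup>+\<omega>. ennreal (w \<omega> * indicator D \<omega>) \<partial>M)"
    proof (rule nn_integral_eq_integral[OF int_wD, symmetric])
      show "AE \<omega> in M. 0 \<le> w \<omega> * indicator D \<omega>"
        using w_pos by eventually_elim (simp add: indicator_def)
    qed
    also have "\<dots> = (\<integral>\<^sup>+\<omega>. ennreal (w \<omega>) * indicator D \<omega> \<partial>M)"
      by (rule nn_integral_cong) (simp add: indicator_def)
    finally show "emeasure N1 ?Z = emeasure N2 ?Z"
      unfolding N1[OF Z] N2[OF Z] preimage .
  qed (simp_all add: N1_def N2_def)
  define A where "A = {S \<in> configurations. \<not> Q S}"
  have A [measurable]: "A \<in> sets configuration_algebra"
    using Q unfolding A_def space_configuration_algebra[symmetric] by measurable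
  have "AE \<omega> in M. Q (process \<omega>)" using AE_Q AE_law[OF Q] by simp
  then have "AE \<omega> in M. \<omega> \<notin> void \<inter> (rest -` A \<inter> space M)"
    by eventually_elim (auto simp: A_def rest_void)
  then have "emeasure M (void \<inter> (rest -` A \<inter> space M)) = 0"
    by (rule iffD1[OF AE_iff_measurable, rotated 2]) auto
  then have "(\<integral>\<^sup>+\<omega>. ennreal (w \<omega>) * indicator (rest -` A \<inter> space M) \<omega> \<partial>M) = 0"
    using N1[OF A] N2[OF A] \<open>N1 = N2\<close> by simp
  then have "AE \<omega> in M. ennreal (w \<omega>) * indicator (rest -` A \<inter> space M) \<omega> = 0"
    by (subst (asm) nn_integral_0_iff_AE) measurable
  then have "AE \<omega> in M. Q (rest \<omega>)"
    using w_pos AE_space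
  proof eventually_elim
    case (elim \<omega>)
    then have "rest \<omega> \<notin> A" by (auto simp: indicator_def)
    then show ?case using rest_conf[OF elim(3)] by (simp add: A_def)
  qed
  moreover have "Measurable.pred configuration_algebra (\<lambda>S. Q (S - U))"
  proof -
    have "(\<lambda>S. S - U) \<in> measurable configuration_algebra configuration_algebra"
    proof (rule measurable_into_configuration_algebra)
      fix B :: "('a \<times> real) set" assume "B \<in> windows"
      then have "B - U \<in> windows" using U by (intro windows_Diff windows_sets)
      moreover have "(S - U) \<inter> B = S \<inter> (B - U)" for S :: "('a \<times> real) set" by auto
      ultimately show "(\<lambda>S. card ((S - U) \<inter> B)) \<in> measurable configuration_algebra (count_space UNIV)"
        using measurable_count by simp
    qed (auto intro: configurations_subset)
    from measurable_compose[OF this Q] show ?thesis .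
  qed
  ultimately show ?thesis by (simp add: AE_law rest_def)
qed
section \<open>Absence of percolation\<close>


text \<open>Almost surely no finite union of cells can be deleted so as to produce an end. The finite set
  of points to be deleted can always be cut out by finitely many cells, of which there are only countably
  many choices.\<close>

lemma AE_no_infinite_component:
  assumes "edge_rule G"
  shows "AE S in law. \<forall>s\<in>S. finite ((G S)\<^sup>* `` {s})"
proof -
  interpret edge_rule G by (rule assms)
  have no_end: "AE S in law. \<not> has_ray_end S"
    by (rule no_ray_end_if_stationary[OF sets_law law_stationary law_intensity])
  have "AE S in law. \<not> has_ray_end (S - (\<Union>n\<in>T. cell n))" if "finite T" for T
    by (rule deletion_tolerance[OF windows_UN[OF that cell_windows] _ no_end]) measurable
  then have "AE S in law. \<forall>T\<in>Collect finite. \<not> has_ray_end (S - (\<Union>n\<in>T. cell n))"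
    by (subst AE_ball_countable[OF countable_Collect_finite]) simp
  then show ?thesis
    using AE_space
  proof eventually_elim
    case (elim S)
    then have S: "S \<in> configurations" by (simp add: law_def)
    show ?case
    proof (rule ballI, rule ccontr)
      fix s assume "s \<in> S" "infinite ((G S)\<^sup>* `` {s})"
      from exists_pruning[OF this] obtain F where F: "finite F" "F \<subseteq> S"
        and e: "\<exists>e\<in>S - F. ray_end (G (S - F)) e" by blast
      obtain T where T: "finite T" "S \<inter> (\<Union>n\<in>T. cell n) = F"
        using cells_separate[OF S F] by blast
      then have "S - (\<Union>n\<in>T. cell n) = S - F" by blast
      then show False using elim(1) T(1) e by (auto simp: has_ray_end_def)
    qed
  qed
qed

lemma heard_process:
  assumes inj: "inj_on (\<lambda>i. X i \<omega>) (I \<omega>)" and ij: "i \<in> I \<omega>" "j \<in> I \<omega>"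
  shows "heard \<tau> N\<^sub>o ell \<gamma> (process \<omega>) (X i \<omega>, P i \<omega>) (X j \<omega>, P j \<omega>)
    \<longleftrightarrow> sinr_condition \<tau> N\<^sub>o ell \<gamma> (I \<omega>) (\<lambda>i. X i \<omega>) (\<lambda>i. P i \<omega>) i j"
proof -
  let ?f = "\<lambda>i. (X i \<omega>, P i \<omega>)"
  have inj': "inj_on ?f (I \<omega>)" using inj by (auto simp: inj_on_def)
  have "process \<omega> - {?f i, ?f j} = ?f ` (I \<omega> - {i, j})"
    using inj' ij inj by (auto simp: process_def inj_on_def)
  then have "(\<Sum>\<^sub>\<infinity>u\<in>process \<omega> - {?f i, ?f j}. received ell u (?f j))
      = (\<Sum>\<^sub>\<infinity>k\<in>I \<omega> - {i, j}. received ell (?f k) (?f j))"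
    using inj_on_subset[OF inj'] by (simp add: infsum_reindex o_def)
  then show ?thesis
    by (simp add: heard_def sinr_condition_def interference_def received_def)
qed

lemma percolates_imp_infinite_component:
  assumes inj: "inj_on (\<lambda>i. X i \<omega>) (I \<omega>)"
    and perc: "percolates ((\<lambda>i. X i \<omega>) ` I \<omega>)
      (sinr_edges \<tau> N\<^sub>o ell \<gamma> (I \<omega>) (\<lambda>i. X i \<omega>) (\<lambda>i. P i \<omega>))"
  shows "\<exists>s\<in>process \<omega>. infinite ((sinr_graph \<tau> N\<^sub>o ell \<gamma> (process \<omega>))\<^sup>* `` {s})"
proof -
  let ?E = "sinr_edges \<tau> N\<^sub>o ell \<gamma> (I \<omega>) (\<lambda>i. X i \<omega>) (\<lambda>i. P i \<omega>)"
  let ?G = "sinr_graph \<tau> N\<^sub>o ell \<gamma> (process \<omega>)"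
  let ?f = "\<lambda>i. (X i \<omega>, P i \<omega>)"
  have proc: "process \<omega> = ?f ` I \<omega>" using inj by (simp add: process_def)
  from perc obtain i where i: "i \<in> I \<omega>" and unb: "\<not> bounded (?E\<^sup>* `` {X i \<omega>})"
    by (auto simp: percolates_def)
  have reach: "\<exists>j\<in>I \<omega>. y = X j \<omega> \<and> (?f i, ?f j) \<in> ?G\<^sup>*" if "(X i \<omega>, y) \<in> ?E\<^sup>*" for y
    using that
  proof (induction rule: rtrancl_induct)
    case base
    then show ?case using i by auto
  next
    case (step y z)
    then obtain j where j: "j \<in> I \<omega>" "y = X j \<omega>" "(?f i, ?f j) \<in> ?G\<^sup>*" by blast
    from step.hyps(2) obtain j' k where jk: "y = X j' \<omega>" "z = X k \<omega>" "j' \<in> I \<omega>" "k \<in> I \<omega>" "X j' \<omega> \<noteq> X k \<omega>"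
      "sinr_condition \<tau> N\<^sub>o ell \<gamma> (I \<omega>) (\<lambda>i. X i \<omega>) (\<lambda>i. P i \<omega>) j' k"
      "sinr_condition \<tau> N\<^sub>o ell \<gamma> (I \<omega>) (\<lambda>i. X i \<omega>) (\<lambda>i. P i \<omega>) k j'"
      unfolding sinr_edges_def by blast
    have "j' = j" using inj_onD[OF inj] j jk by metis
    with jk have "(?f j, ?f k) \<in> ?G"
      using heard_process[OF inj] by (simp add: sinr_graph_def proc)
    from rtrancl_into_rtrancl[OF j(3) this] jk(2,4) show ?case by blast
  qed
  have "infinite (?G\<^sup>* `` {?f i})"
  proof
    assume "finite (?G\<^sup>* `` {?f i})"
    moreover have "?E\<^sup>* `` {X i \<omega>} \<subseteq> fst ` (?G\<^sup>* `` {?f i})"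
    proof
      fix y assume "y \<in> ?E\<^sup>* `` {X i \<omega>}"
      then obtain j where "y = X j \<omega>" "(?f i, ?f j) \<in> ?G\<^sup>*" using reach by blast
      then show "y \<in> fst ` (?G\<^sup>* `` {?f i})" by (intro image_eqI[of _ _ "?f j"]) auto
    qed
    ultimately have "finite (?E\<^sup>* `` {X i \<omega>})" by (meson finite_imageI finite_subset)
    with unb show False using finite_imp_bounded by blast
  qed
  then show ?thesis using i by (auto simp: proc)
qed

lemma AE_not_percolates:
  assumes ell: "ell \<in> borel_measurable (restrict_space borel {0..})"
    and "\<tau> > 0" "\<gamma> > 1 / (2 * \<tau>)"
  shows "AE \<omega> in M. \<not> percolates ((\<lambda>i. X i \<omega>) ` I \<omega>)
    (sinr_edges \<tau> N\<^sub>o ell \<gamma> (I \<omega>) (\<lambda>i. X i \<omega>) (\<lambda>i. P i \<omega>))"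
proof -
  have "AE S in law. \<forall>s\<in>S. finite ((sinr_graph \<tau> N\<^sub>o ell \<gamma> S)\<^sup>* `` {s})"
    by (rule AE_no_infinite_component[OF edge_rule_sinr_graph[OF assms]])
  then have "AE \<omega> in M. \<forall>s\<in>process \<omega>. finite ((sinr_graph \<tau> N\<^sub>o ell \<gamma> (process \<omega>))\<^sup>* `` {s})"
    unfolding law_def by (rule AE_distrD[OF measurable_process])
  with simple_AE show ?thesis
    by eventually_elim (use percolates_imp_infinite_component in blast)
qed

end

theorem theorem2p2:
  fixes M :: "'w measure"
    and \<Lambda> :: "'w \<Rightarrow> 'a::euclidean_space measure"
    and \<mu> :: "real measure"
    and I :: "real \<Rightarrow> 'w \<Rightarrow> nat set"
    and X :: "real \<Rightarrow> nat \<Rightarrow> 'w \<Rightarrow> 'a"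
    and P :: "real \<Rightarrow> nat \<Rightarrow> 'w \<Rightarrow> real"
    and ell :: "real \<Rightarrow> real"
    and \<tau> N\<^sub>o lam :: real
  assumes "prob_space M"
    and "stationary_random_measure M \<Lambda>"
    and "(\<integral>\<^sup>+\<omega>. emeasure (\<Lambda> \<omega>) unit_cube \<partial>M) = 1"
    and "prob_space \<mu>" and "sets \<mu> = sets mark_space"
    and "ell \<in> borel_measurable (restrict_space borel {0..})"
    and "\<And>r. r \<ge> 0 \<Longrightarrow> ell r \<ge> 0"
    and "\<And>a. a > 0 \<Longrightarrow> marked_cox_process M \<Lambda> \<mu> a (I a) (X a) (P a)"
    and "\<And>a. a > 0 \<Longrightarrow> nonequidistant M (I a) (X a)"
    and "N\<^sub>o \<ge> 0" and "\<tau> > 0" and "lam > 0"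
  shows "critical_gamma M \<tau> N\<^sub>o ell (I lam) (X lam) (P lam) \<le> ennreal (1 / (2 * \<tau>))"
proof -
  have "nonequidistant M (I lam) (X lam)" by (rule assms(9)[OF \<open>lam > 0\<close>])
  \<comment> \<open>Distinct points have distinct norms, hence distinct locations.\<close>
  then have simple: "AE \<omega> in M. inj_on (\<lambda>i. X lam i \<omega>) (I lam \<omega>)"
    unfolding nonequidistant_def by (rule AE_mp) (auto simp: inj_on_def intro!: AE_I2)
  interpret cox_process M \<Lambda> \<mu> lam "I lam" "X lam" "P lam"
    using assms simple by (intro cox_process.intro cox_process_axioms.intro) auto
  show ?thesis
    unfolding critical_gamma_def
  proof (rule Sup_least, elim CollectE exE conjE)
    fix x \<gamma> assume x: "x = ennreal \<gamma>" and "\<gamma> > 0"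
      and pos: "0 < measure M {\<omega>\<in>space M. percolates ((\<lambda>i. X lam i \<omega>) ` I lam \<omega>)
         (sinr_edges \<tau> N\<^sub>o ell \<gamma> (I lam \<omega>) (\<lambda>i. X lam i \<omega>) (\<lambda>i. P lam i \<omega>))}" (is "0 < measure M ?A")
    have "\<gamma> \<le> 1 / (2 * \<tau>)"
    proof (rule ccontr)
      assume "\<not> \<gamma> \<le> 1 / (2 * \<tau>)"
      then have "1 / (2 * \<tau>) < \<gamma>" by simp
      from AE_not_percolates[OF assms(6) \<open>\<tau> > 0\<close> this, of N\<^sub>o]
      have AE: "AE \<omega> in M. \<omega> \<notin> ?A" by eventually_elim simp
      \<comment> \<open>A set of positive measure is measurable, since \<^const>\<open>measure\<close> vanishes elsewhere.\<close>
      have "?A \<in> sets M" using pos measure_notin_sets by fastforce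
      then have "emeasure M ?A = 0"
        using AE by (intro iffD1[OF AE_iff_measurable, of ?A M "\<lambda>\<omega>. \<omega> \<notin> ?A"]) auto
      then show False using pos by (simp add: measure_def)
    qed
    then show "x \<le> ennreal (1 / (2 * \<tau>))" unfolding x by (rule ennreal_leI)
  qed
qed

end
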